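(* $H'\not\leq H^{\omega+}$.
   Context: A ceer is an equivalence relation on $\mathbb N$ c.e. as a subset of $\mathbb N^2$; $R_1\leq R_2$ means there is a total computable $f$ with $xR_1y\Leftrightarrow f(x)R_2f(y)$. With $\varphi_e$ the standard enumeration of partial computable functions, $xHy\Leftrightarrow x=y\lor\varphi_x(x)\!\downarrow\,=\varphi_y(y)\!\downarrow$, and the halting jump of a ceer $E$ is $xE'y\Leftrightarrow x=y\lor(\varphi_x(x)\!\downarrow,\varphi_y(y)\!\downarrow,\ \varphi_x(x)E\varphi_y(y))$. The saturation jump $E^+$ is the equivalence relation on finite subsets of $\mathbb N$ (identified with $\mathbb N$ via a fixed computable bijection) given by $xE^+y\Leftrightarrow[x]_E=[y]_E$, where $[X]_E=\{y:\exists x\in X(xEy)\}$. For a ceer $R$, fix a computable pairing $\langle\cdot,\cdot\rangle$ and define ceers $E_n$ by: $\langle x,0\rangle E_0\langle y,0\rangle\Leftrightarrow xRy$; $\langle x,i\rangle E_{n+1}\langle y,i\rangle\Leftrightarrow x=y\lor(i\leq n\wedge\langle x,i\rangle E_n\langle y,i\rangle)\lor(i=n+1\wedge xE_n^+y)$ (in each definition no other pairs of distinct numbers are related, and $x,y$ in $xE_n^+y$ are read as codes of finite sets). Then $xR^{\omega+}y\Leftrightarrow\exists n\,(xE_ny)$. *)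

theory Defs
  imports Main "HOL-Library.Nat_Bijection"
begin

text \<open>
  Partial computable functions are Kleene's partial recursive functions, presented as unary
  functions: several arguments are packed with the bijective pairing function
  \<^const>\<open>prod_encode\<close>. The identity is \<open>PairP FstP SndP\<close>.
\<close>

datatype prog =
    ZeroP
  | SuccP
  | FstP
  | SndP
  | PairP prog prog
  | CompP prog prog
  | PrimRecP prog prog
  | MuP prog

inductive computes :: "prog \<Rightarrow> nat \<Rightarrow> nat \<Rightarrow> bool" where
  zero: "computes ZeroP x 0"
| succ: "computes SuccP x (Suc x)"
| fst: "computes FstP (prod_encode (x, y)) x"
| snd: "computes SndP (prod_encode (x, y)) y"
| pair: "computes p x y \<Longrightarrow> computes q x z \<Longrightarrow> computes (PairP p q) x (prod_encode (y, z))"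
| comp: "computes q x y \<Longrightarrow> computes p y z \<Longrightarrow> computes (CompP p q) x z"
| rec_0: "computes p x y \<Longrightarrow> computes (PrimRecP p q) (prod_encode (x, 0)) y"
| rec_Suc: "computes (PrimRecP p q) (prod_encode (x, n)) y \<Longrightarrow>
    computes q (prod_encode (x, prod_encode (n, y))) z \<Longrightarrow>
    computes (PrimRecP p q) (prod_encode (x, Suc n)) z"
| mu: "computes p (prod_encode (x, n)) 0 \<Longrightarrow>
    (\<forall>m<n. \<exists>y. computes p (prod_encode (x, m)) (Suc y)) \<Longrightarrow>
    computes (MuP p) x n"

inductive_cases computes_elims:
  "computes ZeroP x y" "computes SuccP x y" "computes FstP x y" "computes SndP x y"
  "computes (PairP p q) x y" "computes (CompP p q) x y" "computes (PrimRecP p q) x y"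
  "computes (MuP p) x y"

lemma computes_deterministic:
  "computes p x y \<Longrightarrow> computes p x z \<Longrightarrow> y = z"
proof (induction p x y arbitrary: z rule: computes.induct)
  case (mu p x n)
  from mu.prems obtain k where k: "z = k" "computes p (prod_encode (x, k)) 0"
    "\<forall>m<k. \<exists>y. computes p (prod_encode (x, m)) (Suc y)"
    by (blast elim: computes_elims)
  have "\<not> n < k"
    using k(3) mu.IH by (metis nat.distinct(1))
  moreover have "\<not> k < n"
    using k(2) mu.IH by (metis nat.distinct(1))
  ultimately show ?case
    using k(1) by simp
next
  case (rec_0 p x y q)
  from rec_0.prems show ?case
    by (rule computes_elims) (auto simp: prod_encode_eq rec_0.IH)
next
  case (rec_Suc p q x n y w)
  from rec_Suc.prems show ?case
    by (rule computes_elims) (auto simp: prod_encode_eq dest: rec_Suc.IH)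
qed (blast elim: computes_elims | force elim: computes_elims simp: prod_encode_eq)+

primrec prog_encode :: "prog \<Rightarrow> nat" where
  "prog_encode ZeroP = 0"
| "prog_encode SuccP = 1"
| "prog_encode FstP = 2"
| "prog_encode SndP = 3"
| "prog_encode (PairP p q) = 4 * prod_encode (prog_encode p, prog_encode q) + 4"
| "prog_encode (CompP p q) = 4 * prod_encode (prog_encode p, prog_encode q) + 5"
| "prog_encode (PrimRecP p q) = 4 * prod_encode (prog_encode p, prog_encode q) + 6"
| "prog_encode (MuP p) = 4 * prog_encode p + 7"

lemma inj_prog_encode: "inj prog_encode"
proof (rule injI)
  show "prog_encode p = prog_encode q \<Longrightarrow> p = q" for p q
  proof (induction p arbitrary: q)
    case ZeroP then show ?case by (cases q) auto
  next
    case SuccP then show ?case by (cases q) auto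
  next
    case FstP then show ?case by (cases q) auto
  next
    case SndP then show ?case by (cases q) auto
  next
    case (PairP p1 p2) then show ?case by (cases q) (auto simp: prod_encode_eq, presburger+)
  next
    case (CompP p1 p2) then show ?case by (cases q) (auto simp: prod_encode_eq, presburger+)
  next
    case (PrimRecP p1 p2) then show ?case by (cases q) (auto simp: prod_encode_eq, presburger+)
  next
    case (MuP p) then show ?case by (cases q) (auto, presburger+)
  qed
qed

lemma surj_prog_encode: "surj prog_encode"
proof -
  have "\<exists>p. prog_encode p = n" for n
  proof (induction n rule: less_induct)
    case (less n)
    show ?case
    proof (cases "n < 4")
      case True
      then have "n = 0 \<or> n = 1 \<or> n = 2 \<or> n = 3" by auto
      then show ?thesis
        by (metis prog_encode.simps(1-4))
    next
      case False
      define m where "m = (n - 4) div 4"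
      obtain a b where ab: "m = prod_encode (a, b)"
        by (metis prod_decode_inverse surj_pair)
      have "m < n" "a \<le> m" "b \<le> m"
        using False ab le_prod_encode_1 le_prod_encode_2 by (auto simp: m_def)
      then obtain p q r where
        pqr: "prog_encode p = a" "prog_encode q = b" "prog_encode r = m"
        using less.IH by (meson le_less_trans)
      have "n = 4 * m + 4 \<or> n = 4 * m + 5 \<or> n = 4 * m + 6 \<or> n = 4 * m + 7"
        using False unfolding m_def by presburger
      then show ?thesis
        using pqr ab by (metis prog_encode.simps(5-8))
    qed
  qed
  then show ?thesis by (metis surjI)
qed

lemma bij_prog_encode: "bij prog_encode"
  using inj_prog_encode surj_prog_encode by (rule bijI)

definition prog_decode :: "nat \<Rightarrow> prog" where
  "prog_decode = inv prog_encode"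

text \<open>The standard enumeration: \<open>phi e\<close> is the partial function with index \<open>e\<close>.\<close>

definition phi :: "nat \<Rightarrow> nat \<rightharpoonup> nat" where
  "phi e x = (if \<exists>y. computes (prog_decode e) x y
    then Some (THE y. computes (prog_decode e) x y) else None)"

lemma phi_eq_Some_iff: "phi e x = Some y \<longleftrightarrow> computes (prog_decode e) x y"
  unfolding phi_def by (auto intro: the_equality theI dest: computes_deterministic)

definition total_computable :: "(nat \<Rightarrow> nat) \<Rightarrow> bool" where
  "total_computable f \<longleftrightarrow> (\<exists>e. \<forall>x. phi e x = Some (f x))"

definition reducible :: "nat rel \<Rightarrow> nat rel \<Rightarrow> bool" (infix "\<le>\<^sub>c" 50) where
  "R \<le>\<^sub>c S \<longleftrightarrow> (\<exists>f. total_computable f \<and> (\<forall>x y. (x, y) \<in> R \<longleftrightarrow> (f x, f y) \<in> S))"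

definition H_rel :: "nat rel" where
  "H_rel = {(x, y). x = y \<or> (\<exists>v. phi x x = Some v \<and> phi y y = Some v)}"

definition halting_jump :: "nat rel \<Rightarrow> nat rel" where
  "halting_jump E =
    {(x, y). x = y \<or> (\<exists>u v. phi x x = Some u \<and> phi y y = Some v \<and> (u, v) \<in> E)}"

text \<open>
  Finite sets are coded by the bijection \<^const>\<open>set_encode\<close> (binary expansion), with inverse
  \<^const>\<open>set_decode\<close>. The saturation of \<open>X\<close> under \<open>E\<close> is the image \<open>E `` X\<close>.
\<close>

definition saturation_jump :: "nat rel \<Rightarrow> nat rel" where
  "saturation_jump E = {(x, y). E `` set_decode x = E `` set_decode y}"

primrec omega_stage :: "nat rel \<Rightarrow> nat \<Rightarrow> nat rel" where
  "omega_stage R 0 =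
    Id \<union> {(prod_encode (x, 0), prod_encode (y, 0)) | x y. (x, y) \<in> R}"
| "omega_stage R (Suc n) =
    {(prod_encode (x, i), prod_encode (y, i)) | x y i.
      x = y \<or>
      (i \<le> n \<and> (prod_encode (x, i), prod_encode (y, i)) \<in> omega_stage R n) \<or>
      (i = Suc n \<and> (x, y) \<in> saturation_jump (omega_stage R n))}"

definition omega_jump :: "nat rel \<Rightarrow> nat rel" where
  "omega_jump R = (\<Union>n. omega_stage R n)"

end

theory Submission
  imports Defs "HOL.Filter"
begin

text \<open>
  An element of \<open>H\<^sup>\<omega>\<^sup>+\<close> is a hereditarily finite set over finitely many atoms, its support, and
  each atom can change only once, namely when the corresponding computation converges. An
  atom that has not converged cannot disappear from a set, so equivalent sets have the same
  unconverged atoms.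

  Suppose \<open>f\<close> reduces \<open>H'\<close> to \<open>H\<^sup>\<omega>\<^sup>+\<close>. By self-reference we control tokens \<open>Y\<^sub>j\<close>, which halt with
  one of the names \<open>A\<^sub>i\<close>, and the names, which may later halt with a number. Thinning out the
  tokens gives \<open>z\<close> and disjoint pairs \<open>p\<^sub>i, q\<^sub>i\<close> such that the supports of \<open>f Y\<^sub>p\<close> and \<open>f Y\<^sub>q\<close> meet
  inside that of \<open>f Y\<^sub>z\<close>. Giving \<open>Y\<^sub>0, Y\<^sub>z\<close> the same name and \<open>p\<^sub>i, q\<^sub>i\<close> the name \<open>A\<^sub>i\<close> forces every atom of
  these sets outside the support of \<open>f Y\<^sub>0\<close> to converge. After that we identify \<open>A\<^sub>0\<close> with \<open>A\<^sub>1\<close>, then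
  \<open>A\<^sub>2\<close> with \<open>A\<^sub>3\<close>, and so on, each time waiting until the approximation to \<open>H\<^sup>\<omega>\<^sup>+\<close> has caught up. Each
  identification forces a further atom of the fixed finite support of \<open>f Y\<^sub>0\<close> to converge.
\<close>

section \<open>Computable functions and decidable predicates\<close>

abbreviation pr :: "nat \<Rightarrow> nat \<Rightarrow> nat" where
  "pr a b \<equiv> prod_encode (a, b)"

definition pf :: "nat \<Rightarrow> nat" where "pf z = fst (prod_decode z)"
definition ps :: "nat \<Rightarrow> nat" where "ps z = snd (prod_decode z)"

lemma pf_pr [simp]: "pf (pr a b) = a" and ps_pr [simp]: "ps (pr a b) = b"
  by (simp_all add: pf_def ps_def)

lemma pr_pf_ps [simp]: "pr (pf z) (ps z) = z"
  by (simp add: pf_def ps_def)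

lemma pr_eq [simp]: "pr a b = pr c d \<longleftrightarrow> a = c \<and> b = d"
  by (simp add: prod_encode_eq)

lemma pr_cases: obtains a b where "z = pr a b"
  by (metis pr_pf_ps)

definition computable :: "(nat \<Rightarrow> nat) \<Rightarrow> bool" where
  "computable f \<longleftrightarrow> (\<exists>p. \<forall>x. computes p x (f x))"

text \<open>Truth is coded by 0 because \<open>MuP\<close> searches for the first argument at which
  its program returns 0.\<close>

definition decidable :: "(nat \<Rightarrow> bool) \<Rightarrow> bool" where
  "decidable P \<longleftrightarrow> computable (\<lambda>x. if P x then 0 else 1)"

named_theorems comp_intros

lemma computable_compose:
  assumes "computable f" "computable g"
  shows "computable (\<lambda>x. f (g x))"
  using assms unfolding computable_def by (meson computes.comp)

lemma computable_pr [comp_intros]: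
  assumes "computable f" "computable g"
  shows "computable (\<lambda>x. pr (f x) (g x))"
  using assms unfolding computable_def by (meson computes.pair)

lemma computes_FstP: "computes FstP z (pf z)" and computes_SndP: "computes SndP z (ps z)"
  using computes.fst[of "pf z" "ps z"] computes.snd[of "pf z" "ps z"] by simp_all

lemma computable_pf0: "computable pf" and computable_ps0: "computable ps"
  unfolding computable_def using computes_FstP computes_SndP by blast+

lemma computable_Suc0: "computable Suc"
  unfolding computable_def using computes.succ by blast

lemmas computable_pf [comp_intros] = computable_compose[OF computable_pf0]
lemmas computable_ps [comp_intros] = computable_compose[OF computable_ps0]
lemmas computable_Suc [comp_intros] = computable_compose[OF computable_Suc0]

lemma computable_id [comp_intros]: "computable (\<lambda>x. x)"
  using computable_pr[OF computable_pf0 computable_ps0] by simp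

lemma computable_const [comp_intros]: "computable (\<lambda>x. c)"
proof (induction c)
  case 0
  show ?case unfolding computable_def using computes.zero by blast
next
  case (Suc c)
  then show ?case by (rule computable_Suc)
qed

text \<open>Addition, multiplication, powers of two, subtraction and bounded quantification all come
  from writing the function in question as an instance of \<open>rec_nat\<close>.\<close>

lemma computable_rec_nat:
  assumes "computable f" "computable (\<lambda>z. h (pf z) (pf (ps z)) (ps (ps z)))" "computable b"
  shows "computable (\<lambda>x. rec_nat (f x) (h x) (b x))"
proof -
  obtain p q where p: "\<And>x. computes p x (f x)"
    and q: "\<And>z. computes q z (h (pf z) (pf (ps z)) (ps (ps z)))"
    using assms unfolding computable_def by metis
  have "computes (PrimRecP p q) (pr x n) (rec_nat (f x) (h x) n)" for x n
  proof (induction n)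
    case 0
    show ?case using p by (simp add: computes.rec_0)
  next
    case (Suc n)
    show ?case
      using computes.rec_Suc[OF Suc] q[of "pr x (pr n (rec_nat (f x) (h x) n))"] by simp
  qed
  then have "computable (\<lambda>z. rec_nat (f (pf z)) (h (pf z)) (ps z))"
    unfolding computable_def by (metis pr_pf_ps)
  from computable_compose[OF this computable_pr[OF computable_id assms(3)]]
  show ?thesis by simp
qed

lemma computable_add [comp_intros]:
  assumes "computable f" "computable g"
  shows "computable (\<lambda>x. f x + g x)"
proof -
  have "rec_nat a (\<lambda>n. Suc) b = a + b" for a b :: nat
    by (induction b) auto
  then show ?thesis
    using computable_rec_nat[of f "\<lambda>x n. Suc" g] assms by (simp add: comp_intros)
qed

lemma computable_mult [comp_intros]:
  assumes "computable f" "computable g"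
  shows "computable (\<lambda>x. f x * g x)"
proof -
  have "rec_nat 0 (\<lambda>n r. r + a) b = a * b" for a b :: nat
    by (induction b) auto
  then show ?thesis
    using computable_rec_nat[of "\<lambda>x. 0" "\<lambda>x n r. r + f x" g] assms
    by (simp add: comp_intros computable_compose[OF assms(1)])
qed

lemma computable_power2 [comp_intros]:
  assumes "computable g"
  shows "computable (\<lambda>x. 2 ^ g x)"
proof -
  have "rec_nat (Suc 0) (\<lambda>n r. 2 * r) b = 2 ^ b" for b :: nat
    by (induction b) auto
  then show ?thesis
    using computable_rec_nat[of "\<lambda>x. Suc 0" "\<lambda>x n r. 2 * r" g] assms by (simp add: comp_intros)
qed

lemma computable_diff [comp_intros]:
  assumes "computable f" "computable g"
  shows "computable (\<lambda>x. f x - g x)"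
proof -
  have "rec_nat 0 (\<lambda>n r. n) b = b - 1" for b :: nat
    by (induction b) auto
  then have pred: "computable (\<lambda>x. x - 1)"
    using computable_rec_nat[of "\<lambda>x. 0" "\<lambda>x n r. n" "\<lambda>x. x"] by (simp add: comp_intros)
  have "rec_nat a (\<lambda>n r. r - 1) b = a - b" for a b :: nat
    by (induction b) auto
  then show ?thesis
    using computable_rec_nat[of f "\<lambda>x n r. r - 1" g] assms computable_compose[OF pred]
    by (simp add: comp_intros)
qed

section \<open>Decidable predicates and bounded quantifiers\<close>

lemma decidable_compose:
  assumes "decidable P" "computable g"
  shows "decidable (\<lambda>x. P (g x))"
  using computable_compose[OF assms(1)[unfolded decidable_def] assms(2)]
  by (simp add: decidable_def)

lemma decidable_le [comp_intros]:
  assumes "computable f" "computable g"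
  shows "decidable (\<lambda>x. f x \<le> g x)"
proof -
  have "(if f x \<le> g x then 0 else 1) = 1 - (1 - (f x - g x))" for x by auto
  with assms show ?thesis
    unfolding decidable_def by (auto intro!: comp_intros)
qed

lemma decidable_not [comp_intros]:
  assumes "decidable P"
  shows "decidable (\<lambda>x. \<not> P x)"
proof -
  have "(if \<not> P x then 0 else 1) = 1 - (if P x then 0 else (1::nat))" for x by auto
  then show ?thesis
    using assms unfolding decidable_def
    by (simp only:) (rule computable_diff[OF computable_const])
qed

lemma decidable_conj [comp_intros]:
  assumes "decidable P" "decidable Q"
  shows "decidable (\<lambda>x. P x \<and> Q x)"
proof -
  have "(if P x \<and> Q x then 0 else 1) =
      1 - (1 - ((if P x then 0 else 1) + (if Q x then 0 else (1::nat))))" for x by auto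
  moreover have "computable (\<lambda>x. 1 - (1 - ((if P x then 0 else 1) + (if Q x then 0 else 1))))"
    by (intro comp_intros assms[unfolded decidable_def])
  ultimately show ?thesis
    unfolding decidable_def by presburger
qed

lemma decidable_disj [comp_intros]:
  assumes "decidable P" "decidable Q"
  shows "decidable (\<lambda>x. P x \<or> Q x)"
  using decidable_not[OF decidable_conj[OF decidable_not[OF assms(1)] decidable_not[OF assms(2)]]]
  unfolding de_Morgan_conj not_not .

lemma decidable_imp [comp_intros]:
  assumes "decidable P" "decidable Q"
  shows "decidable (\<lambda>x. P x \<longrightarrow> Q x)"
  unfolding imp_conv_disj by (intro comp_intros assms)

lemma decidable_less [comp_intros]:
  assumes "computable f" "computable g"
  shows "decidable (\<lambda>x. f x < g x)"
  using decidable_le[OF computable_Suc[OF assms(1)] assms(2)] unfolding Suc_le_eq .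

lemma decidable_eq [comp_intros]:
  assumes "computable f" "computable g"
  shows "decidable (\<lambda>x. f x = g x)"
  using decidable_conj[OF decidable_le[OF assms] decidable_le[OF assms(2,1)]]
  unfolding eq_iff[of "f _"] .

lemma computable_if [comp_intros]:
  assumes "decidable P" "computable f" "computable g"
  shows "computable (\<lambda>x. if P x then f x else g x)"
proof -
  have "(if P x then f x else g x) =
      (1 - (if P x then 0 else 1)) * f x + (if P x then 0 else 1) * g x" for x by auto
  moreover have "computable (\<lambda>x. (1 - (if P x then 0 else 1)) * f x + (if P x then 0 else 1) * g x)"
    by (intro comp_intros assms(2,3) assms(1)[unfolded decidable_def])
  ultimately show ?thesis by presburger
qed

lemma decidable_all_less [comp_intros]:
  assumes "decidable (\<lambda>z. P (pf z) (ps z))" "computable b"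
  shows "decidable (\<lambda>x. \<forall>y<b x. P x y)"
proof -
  \<comment> \<open>The recursion carries the verdict so far: it becomes 1 at the first
    counterexample and stays there.\<close>
  have eq: "rec_nat 0 (\<lambda>n r. if r = 0 \<and> P x n then 0 else 1) b = (if \<forall>y<b. P x y then 0 else 1)"
    for x and b :: nat
    by (induction b) (auto simp: less_Suc_eq)
  have "decidable (\<lambda>z. P (pf z) (pf (ps z)))"
    using decidable_compose[OF assms(1), of "\<lambda>z. pr (pf z) (pf (ps z))"] by (simp add: comp_intros)
  then have "computable (\<lambda>z. if ps (ps z) = 0 \<and> P (pf z) (pf (ps z)) then 0 else 1)"
    by (intro comp_intros)
  from computable_rec_nat[OF computable_const[of 0] this assms(2)] show ?thesis
    unfolding decidable_def eq .
qed

lemma decidable_all_le [comp_intros]: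
  assumes "decidable (\<lambda>z. P (pf z) (ps z))" "computable b"
  shows "decidable (\<lambda>x. \<forall>y\<le>b x. P x y)"
  using decidable_all_less[OF assms(1) computable_Suc[OF assms(2)]]
  unfolding less_Suc_eq_le .

lemma decidable_ex_le [comp_intros]:
  assumes "decidable (\<lambda>z. P (pf z) (ps z))" "computable b"
  shows "decidable (\<lambda>x. \<exists>y\<le>b x. P x y)"
  using decidable_not[OF decidable_all_le[OF decidable_not[OF assms(1)] assms(2)]]
  unfolding not_all not_imp not_not .

text \<open>As \<open>p\<close> is total, its values at smaller arguments exist, and being nonzero
  they say exactly that \<open>P\<close> fails there.\<close>

lemma computes_MuP:
  assumes "\<And>z. computes p z (if P (pf z) (ps z) then 0 else 1)"
  shows "computes (MuP p) x n \<longleftrightarrow> P x n \<and> (\<forall>m<n. \<not> P x m)"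
proof
  assume "computes (MuP p) x n"
  then have n: "computes p (pr x n) 0" "\<forall>m<n. \<exists>y. computes p (pr x m) (Suc y)"
    by (auto elim: computes_elims)
  have "P x n"
    using computes_deterministic[OF n(1) assms] by (auto split: if_splits)
  moreover have "\<not> P x m" if "m < n" for m
  proof -
    from n(2) that obtain y where "computes p (pr x m) (Suc y)" by blast
    from computes_deterministic[OF this assms] show ?thesis by (auto split: if_splits)
  qed
  ultimately show "P x n \<and> (\<forall>m<n. \<not> P x m)" by blast
next
  assume n: "P x n \<and> (\<forall>m<n. \<not> P x m)"
  show "computes (MuP p) x n"
  proof (rule computes.mu)
    show "computes p (pr x n) 0" using assms[of "pr x n"] n by simp
    show "\<forall>m<n. \<exists>y. computes p (pr x m) (Suc y)"
      using assms[of "pr x _"] n by (metis One_nat_def pf_pr ps_pr)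
  qed
qed

lemma computable_Least:
  assumes "decidable (\<lambda>z. P (pf z) (ps z))" "\<And>x. \<exists>y. P x y"
  shows "computable (\<lambda>x. LEAST y. P x y)"
proof -
  obtain p where p: "\<And>z. computes p z (if P (pf z) (ps z) then 0 else 1)"
    using assms(1) unfolding decidable_def computable_def by blast
  have "computes (MuP p) x (LEAST y. P x y)" for x
    unfolding computes_MuP[of p P, OF p] using assms(2) by (auto intro: LeastI_ex dest: not_less_Least)
  then show ?thesis unfolding computable_def by blast
qed

lemma decidable_set_decode [comp_intros]:
  assumes "computable f" "computable g"
  shows "decidable (\<lambda>x. f x \<in> set_decode (g x))"
proof -
  \<comment> \<open>Membership means that \<open>c div 2 ^ n\<close> is odd. Sandwiching
    \<open>c\<close> between multiples of \<open>2 ^ n\<close> with a bounded \<open>q\<close>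
    expresses this without division.\<close>
  have "n \<in> set_decode c \<longleftrightarrow> (\<exists>q\<le>c. (2 * q + 1) * 2 ^ n \<le> c \<and> c < (2 * q + 2) * 2 ^ n)" for n c
  proof -
    have "odd (c div 2 ^ n) \<longleftrightarrow> (\<exists>q\<le>c. c div 2 ^ n = 2 * q + 1)"
    proof
      assume "odd (c div 2 ^ n)"
      then obtain q where q: "c div 2 ^ n = 2 * q + 1" by (rule oddE)
      have "c div 2 ^ n \<le> c" by (rule div_le_dividend)
      with q show "\<exists>q\<le>c. c div 2 ^ n = 2 * q + 1" by (intro exI[of _ q]) linarith
    qed auto
    moreover have "c div 2 ^ n = 2 * q + 1 \<longleftrightarrow> (2 * q + 1) * 2 ^ n \<le> c \<and> c < (2 * q + 2) * 2 ^ n" for q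
      unfolding eq_iff[of "c div 2 ^ n"]
      using less_eq_div_iff_mult_less_eq[of "2 ^ n" "2 * q + 1" c]
        div_less_iff_less_mult[of "2 ^ n" c "2 * q + 2"] by auto
    ultimately show ?thesis unfolding set_decode_def by simp
  qed
  moreover have "decidable (\<lambda>x. \<exists>q\<le>g x. (2 * q + 1) * 2 ^ f x \<le> g x \<and> g x < (2 * q + 2) * 2 ^ f x)"
    by (intro comp_intros computable_compose[OF assms(1)] computable_compose[OF assms(2)] assms)
  ultimately show ?thesis by simp
qed

section \<open>Computation tables\<close>

definition mem :: "nat \<Rightarrow> nat \<Rightarrow> nat \<Rightarrow> nat \<Rightarrow> bool" where
  "mem A e x y \<longleftrightarrow> pr e (pr x y) \<in> set_decode A"

text \<open>
  A number \<open>A\<close> codes a finite set of triples (program, input, output). In a table every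
  triple is justified by other triples of the table; such a justification can only refer to
  a subprogram, or to the same primitive recursion at a smaller argument, so no order of
  evaluation has to be recorded.
\<close>

definition justified :: "nat \<Rightarrow> nat \<Rightarrow> nat \<Rightarrow> nat \<Rightarrow> bool" where
  "justified A e x y \<longleftrightarrow>
    e = 0 \<and> y = 0 \<or> e = 1 \<and> y = Suc x \<or> e = 2 \<and> y = pf x \<or> e = 3 \<and> y = ps x \<or>
    (\<exists>p\<le>e. \<exists>q\<le>e. e = 4 * pr p q + 4 \<and> mem A p x (pf y) \<and> mem A q x (ps y)) \<or>
    (\<exists>p\<le>e. \<exists>q\<le>e. e = 4 * pr p q + 5 \<and> (\<exists>m\<le>A. mem A q x m \<and> mem A p m y)) \<or>
    (\<exists>p\<le>e. \<exists>q\<le>e. e = 4 * pr p q + 6 \<and> ps x = 0 \<and> mem A p (pf x) y) \<or>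
    (\<exists>p\<le>e. \<exists>q\<le>e. e = 4 * pr p q + 6 \<and> (\<exists>n\<le>A. \<exists>m\<le>A. ps x = Suc n \<and>
      mem A e (pr (pf x) n) m \<and> mem A q (pr (pf x) (pr n m)) y)) \<or>
    (\<exists>p\<le>e. e = 4 * p + 7 \<and> mem A p (pr x y) 0 \<and> (\<forall>m<y. \<exists>v\<le>A. mem A p (pr x m) (Suc v)))"

definition table :: "nat \<Rightarrow> bool" where
  "table A \<longleftrightarrow> (\<forall>e\<le>A. \<forall>x\<le>A. \<forall>y\<le>A. mem A e x y \<longrightarrow> justified A e x y)"

lemma decidable_mem [comp_intros]:
  assumes "computable a" "computable e" "computable x" "computable y"
  shows "decidable (\<lambda>z. mem (a z) (e z) (x z) (y z))"
  unfolding mem_def by (intro comp_intros assms)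

lemma decidable_table: "decidable table"
  unfolding table_def justified_def by (intro comp_intros)

lemma set_decode_less: "x \<in> set_decode n \<Longrightarrow> x < n"
proof -
  assume "x \<in> set_decode n"
  then have "n div 2 ^ x \<noteq> 0" by (metis even_zero mem_Collect_eq set_decode_def)
  then have "2 ^ x \<le> n" by (metis div_less not_less)
  then show "x < n" using less_exp[of x] by linarith
qed

lemma set_decode_mono:
  assumes "set_decode A \<subseteq> set_decode B"
  shows "A \<le> B"
proof -
  have "set_encode (set_decode A) \<le> set_encode (set_decode B)"
    unfolding set_encode_def using assms by (intro sum_mono2) auto
  then show ?thesis by simp
qed

text \<open>The code of a triple lies below \<open>A\<close> and bounds its components, so the
  bounds by \<open>A\<close> in \<open>table\<close> and \<open>justified\<close>, which give
  decidability, exclude no entry.\<close>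

lemma mem_le:
  assumes "mem A e x y"
  shows "e \<le> A" "x \<le> A" "y \<le> A"
proof -
  have 1: "pr e (pr x y) < A" using assms set_decode_less unfolding mem_def by blast
  have 2: "e \<le> pr e (pr x y)" "pr x y \<le> pr e (pr x y)" "x \<le> pr x y" "y \<le> pr x y"
    by (simp_all add: le_prod_encode_1 le_prod_encode_2)
  show "e \<le> A" "x \<le> A" "y \<le> A"
    using 1 2 by linarith+
qed

lemma tableD: "table A \<Longrightarrow> mem A e x y \<Longrightarrow> justified A e x y"
  unfolding table_def using mem_le by blast

lemma tableI: "(\<And>e x y. mem A e x y \<Longrightarrow> justified A e x y) \<Longrightarrow> table A"
  unfolding table_def by blast

text \<open>Composite programs are told apart by their codes modulo 4 and atomic ones have codes
  below 4, so in \<open>justified\<close> only the clauses of the matching constructor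
  survive.\<close>

lemma code_distinct:
  fixes a b :: nat
  shows "4 * a + 4 \<noteq> 4 * b + 5" "4 * a + 4 \<noteq> 4 * b + 6" "4 * a + 4 \<noteq> 4 * b + 7"
    "4 * a + 5 \<noteq> 4 * b + 6" "4 * a + 5 \<noteq> 4 * b + 7" "4 * a + 6 \<noteq> 4 * b + 7"
    "4 * a + 5 \<noteq> 4 * b + 4" "4 * a + 6 \<noteq> 4 * b + 4" "4 * a + 7 \<noteq> 4 * b + 4"
    "4 * a + 6 \<noteq> 4 * b + 5" "4 * a + 7 \<noteq> 4 * b + 5" "4 * a + 7 \<noteq> 4 * b + 6"
    "4 * a + c = 4 * b + c \<longleftrightarrow> a = b"
  by presburger+

lemma code_small:
  fixes a :: nat
  assumes "c \<ge> 4"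
  shows "4 * a + c \<noteq> 0" "4 * a + c \<noteq> 1" "4 * a + c \<noteq> 2" "4 * a + c \<noteq> 3"
  using assms by linarith+

lemma code_bound: "p \<le> 4 * pr p q + c" "q \<le> 4 * pr p q + c"
  using le_prod_encode_1[of p q] le_prod_encode_2[of q p] by linarith+

lemma justified_PairP:
  assumes "justified A (4 * pr p q + 4) x y"
  shows "mem A p x (pf y) \<and> mem A q x (ps y)"
  using assms unfolding justified_def
  by (elim disjE exE conjE; simp only: code_distinct code_small pr_eq; simp)

lemma justified_CompP:
  assumes "justified A (4 * pr p q + 5) x y"
  shows "\<exists>m. mem A q x m \<and> mem A p m y"
  using assms unfolding justified_def
  by (elim disjE exE conjE; simp only: code_distinct code_small pr_eq; blast)

lemma justified_PrimRecP:
  assumes "justified A (4 * pr p q + 6) x y"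
  shows "ps x = 0 \<and> mem A p (pf x) y \<or>
    (\<exists>n m. ps x = Suc n \<and> mem A (4 * pr p q + 6) (pr (pf x) n) m \<and>
      mem A q (pr (pf x) (pr n m)) y)"
  using assms unfolding justified_def
  by (elim disjE exE conjE; simp only: code_distinct code_small pr_eq; blast)

lemma justified_MuP:
  assumes "justified A (4 * p + 7) x y"
  shows "mem A p (pr x y) 0 \<and> (\<forall>m<y. \<exists>v. mem A p (pr x m) (Suc v))"
  using assms unfolding justified_def
  by (elim disjE exE conjE; simp only: code_distinct code_small pr_eq; blast)

lemma justified_PairI:
  assumes "mem A p x y" "mem A q x z"
  shows "justified A (4 * pr p q + 4) x (pr y z)"
proof -
  have "\<exists>p'\<le>4 * pr p q + 4. \<exists>q'\<le>4 * pr p q + 4. 4 * pr p q + 4 = 4 * pr p' q' + 4 \<and>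
      mem A p' x (pf (pr y z)) \<and> mem A q' x (ps (pr y z))"
    by (intro exI[of _ p] exI[of _ q] conjI code_bound refl; simp only: pf_pr ps_pr assms)
  then show ?thesis unfolding justified_def by (simp only: simp_thms)
qed

lemma justified_CompI:
  assumes "mem A q x m" "mem A p m y"
  shows "justified A (4 * pr p q + 5) x y"
proof -
  have "\<exists>p'\<le>4 * pr p q + 5. \<exists>q'\<le>4 * pr p q + 5. 4 * pr p q + 5 = 4 * pr p' q' + 5 \<and>
      (\<exists>m\<le>A. mem A q' x m \<and> mem A p' m y)"
    by (intro exI[of _ p] exI[of _ q] exI[of _ m] conjI code_bound refl assms mem_le(3)[OF assms(1)])
  then show ?thesis unfolding justified_def by (simp only: simp_thms)
qed

lemma justified_rec_0I:
  assumes "mem A p x y"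
  shows "justified A (4 * pr p q + 6) (pr x 0) y"
proof -
  have "\<exists>p'\<le>4 * pr p q + 6. \<exists>q'\<le>4 * pr p q + 6. 4 * pr p q + 6 = 4 * pr p' q' + 6 \<and>
      ps (pr x 0) = 0 \<and> mem A p' (pf (pr x 0)) y"
    by (intro exI[of _ p] exI[of _ q] conjI code_bound refl; simp only: pf_pr ps_pr assms)
  then show ?thesis unfolding justified_def by (simp only: simp_thms)
qed

lemma justified_rec_SucI:
  assumes "mem A (4 * pr p q + 6) (pr x n) m" "mem A q (pr x (pr n m)) y"
  shows "justified A (4 * pr p q + 6) (pr x (Suc n)) y"
proof -
  have n: "n \<le> A"
    using le_prod_encode_2[of n x] mem_le(2)[OF assms(1)] by linarith
  have "\<exists>p'\<le>4 * pr p q + 6. \<exists>q'\<le>4 * pr p q + 6. 4 * pr p q + 6 = 4 * pr p' q' + 6 \<and>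
      (\<exists>k\<le>A. \<exists>m\<le>A. ps (pr x (Suc n)) = Suc k \<and> mem A (4 * pr p q + 6) (pr (pf (pr x (Suc n))) k) m \<and>
        mem A q' (pr (pf (pr x (Suc n))) (pr k m)) y)"
    by (intro exI[of _ p] exI[of _ q] exI[of _ n] exI[of _ m] conjI code_bound refl n
        mem_le(3)[OF assms(1)]; simp only: pf_pr ps_pr assms)
  then show ?thesis unfolding justified_def by (simp only: simp_thms)
qed

lemma justified_MuI:
  assumes "mem A p (pr x y) 0" "\<And>m. m < y \<Longrightarrow> \<exists>v. mem A p (pr x m) (Suc v)"
  shows "justified A (4 * p + 7) x y"
proof -
  have "\<exists>v\<le>A. mem A p (pr x m) (Suc v)" if "m < y" for m
    using assms(2)[OF that] mem_le(3) Suc_leD by metis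
  then have "\<forall>m<y. \<exists>v\<le>A. mem A p (pr x m) (Suc v)" by blast
  moreover have "p \<le> 4 * p + 7" by simp
  ultimately have "\<exists>p'\<le>4 * p + 7. 4 * p + 7 = 4 * p' + 7 \<and> mem A p' (pr x y) 0 \<and>
      (\<forall>m<y. \<exists>v\<le>A. mem A p' (pr x m) (Suc v))"
    by (intro exI[of _ p] conjI refl assms(1))
  then show ?thesis unfolding justified_def by (simp only: simp_thms)
qed

text \<open>\<open>A\<close> occurs only positively in \<open>justified\<close>, and a larger coded
  set also has a larger code, so the bounds of the quantifiers grow too.\<close>

lemma justified_mono:
  assumes "set_decode A \<subseteq> set_decode B" "justified A e x y"
  shows "justified B e x y"
proof -
  have le: "k \<le> A \<longrightarrow> k \<le> B" for k using set_decode_mono[OF assms(1)] by simp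
  have mem: "mem A e x y \<longrightarrow> mem B e x y" for e x y
    using assms(1) unfolding mem_def by blast
  have "justified A e x y \<longrightarrow> justified B e x y"
    unfolding justified_def
    by (intro disj_mono conj_mono ex_mono all_mono imp_mono imp_refl le mem)
  with assms(2) show ?thesis by blast
qed

lemma table_0: "table 0"
  by (rule tableI) (simp add: mem_def)

lemma table_add:
  assumes "table A" "justified A e x y"
  obtains B where "table B" "set_decode A \<subseteq> set_decode B" "mem B e x y"
proof -
  define B where "B = set_encode (insert (pr e (pr x y)) (set_decode A))"
  have B: "set_decode B = insert (pr e (pr x y)) (set_decode A)"
    unfolding B_def by simp
  have "table B"
  proof (rule tableI)
    fix e' x' y' assume "mem B e' x' y'"
    then have "justified A e' x' y'"
      using assms(2) tableD[OF assms(1)] unfolding mem_def B by auto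
    then show "justified B e' x' y'" using justified_mono B by blast
  qed
  then show thesis using that B unfolding mem_def by blast
qed

lemma table_union:
  assumes "table A" "table B"
  obtains C where "table C" "set_decode A \<subseteq> set_decode C" "set_decode B \<subseteq> set_decode C"
proof -
  define C where "C = set_encode (set_decode A \<union> set_decode B)"
  have C: "set_decode C = set_decode A \<union> set_decode B"
    unfolding C_def by simp
  have "table C"
  proof (rule tableI)
    fix e x y assume "mem C e x y"
    then have "justified A e x y \<or> justified B e x y"
      using tableD[OF assms(1)] tableD[OF assms(2)] unfolding mem_def C by auto
    then show "justified C e x y" using justified_mono C by blast
  qed
  then show thesis using that C by blast
qed

lemma mem_mono: "set_decode A \<subseteq> set_decode B \<Longrightarrow> mem A e x y \<Longrightarrow> mem B e x y"
  unfolding mem_def by blast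

section \<open>Soundness and completeness of tables\<close>

lemma table_sound:
  assumes "table A"
  shows "mem A (prog_encode p) x y \<Longrightarrow> computes p x y"
proof (induction p arbitrary: x y)
  case ZeroP
  from tableD[OF assms ZeroP] show ?case
    unfolding justified_def by (auto intro: computes.intros)
next
  case SuccP
  from tableD[OF assms SuccP] show ?case
    unfolding justified_def by (auto intro: computes.intros)
next
  case FstP
  from tableD[OF assms FstP] show ?case
    unfolding justified_def by (auto intro: computes_FstP)
next
  case SndP
  from tableD[OF assms SndP] show ?case
    unfolding justified_def by (auto intro: computes_SndP)
next
  case (PairP p q)
  have "mem A (prog_encode p) x (pf y)" "mem A (prog_encode q) x (ps y)"
    using justified_PairP tableD[OF assms PairP.prems] by auto
  then have "computes (PairP p q) x (pr (pf y) (ps y))"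
    using PairP.IH by (intro computes.pair)
  then show ?case by simp
next
  case (CompP p q)
  have "\<exists>m. mem A (prog_encode q) x m \<and> mem A (prog_encode p) m y"
    using justified_CompP tableD[OF assms CompP.prems] by auto
  with CompP.IH show ?case by (blast intro: computes.comp)
next
  case (MuP p)
  have "mem A (prog_encode p) (pr x y) 0 \<and> (\<forall>m<y. \<exists>v. mem A (prog_encode p) (pr x m) (Suc v))"
    using justified_MuP tableD[OF assms MuP.prems] by auto
  with MuP.IH show ?case by (blast intro: computes.mu)
next
  case (PrimRecP p q)
  let ?e = "prog_encode (PrimRecP p q)"
  have *: "ps x = 0 \<and> mem A (prog_encode p) (pf x) y \<or>
      (\<exists>n m. ps x = Suc n \<and> mem A ?e (pr (pf x) n) m \<and> mem A (prog_encode q) (pr (pf x) (pr n m)) y)"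
    if "mem A ?e x y" for x y
    using justified_PrimRecP tableD[OF assms that] by auto
  \<comment> \<open>A primitive recursion may be justified by itself at a smaller argument, so the
    induction on programs needs an inner one on the recursion argument.\<close>
  have "mem A ?e (pr a n) y \<Longrightarrow> computes (PrimRecP p q) (pr a n) y" for a n y
  proof (induction n arbitrary: y)
    case 0
    from *[OF 0] show ?case using PrimRecP.IH(1) by (auto intro: computes.rec_0)
  next
    case (Suc n)
    from *[OF Suc.prems] show ?case
      using PrimRecP.IH(2) Suc.IH by (auto intro: computes.rec_Suc)
  qed
  with PrimRecP.prems show ?case by (metis pr_pf_ps)
qed

lemma table_union_mem:
  assumes "table A" "mem A e x y" "table B" "mem B e' x' y'"
  obtains C where "table C" "mem C e x y" "mem C e' x' y'"
  using table_union[OF assms(1,3)] mem_mono assms(2,4) by metis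

lemma table_complete:
  "computes p x y \<Longrightarrow> \<exists>A. table A \<and> mem A (prog_encode p) x y"
proof (induction rule: computes.induct)
  case (zero x)
  have "justified 0 0 x 0" by (simp add: justified_def)
  from table_add[OF table_0 this] show ?case by auto
next
  case (succ x)
  have "justified 0 1 x (Suc x)" by (simp add: justified_def)
  from table_add[OF table_0 this] show ?case by auto
next
  case (fst x y)
  have "justified 0 2 (pr x y) x" by (simp add: justified_def)
  from table_add[OF table_0 this] show ?case by auto
next
  case (snd x y)
  have "justified 0 3 (pr x y) y" by (simp add: justified_def)
  from table_add[OF table_0 this] show ?case by auto
next
  case (pair p x y q z)
  then obtain A B where "table A" "mem A (prog_encode p) x y"
    "table B" "mem B (prog_encode q) x z" by blast
  then obtain C where C: "table C" "mem C (prog_encode p) x y" "mem C (prog_encode q) x z"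
    by (rule table_union_mem)
  from table_add[OF C(1) justified_PairI[OF C(2,3)]] show ?case by auto
next
  case (comp q x y p z)
  then obtain A B where "table A" "mem A (prog_encode q) x y"
    "table B" "mem B (prog_encode p) y z" by blast
  then obtain C where C: "table C" "mem C (prog_encode q) x y" "mem C (prog_encode p) y z"
    by (rule table_union_mem)
  from table_add[OF C(1) justified_CompI[OF C(2,3)]] show ?case by auto
next
  case (rec_0 p x y q)
  then obtain A where A: "table A" "mem A (prog_encode p) x y" by blast
  from table_add[OF A(1) justified_rec_0I[OF A(2), of "prog_encode q"]] show ?case by auto
next
  case (rec_Suc p q x n y z)
  then obtain A B where "table A" "mem A (prog_encode (PrimRecP p q)) (pr x n) y"
    "table B" "mem B (prog_encode q) (pr x (pr n y)) z" by blast
  then obtain C where C: "table C" "mem C (prog_encode (PrimRecP p q)) (pr x n) y"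
    "mem C (prog_encode q) (pr x (pr n y)) z"
    by (rule table_union_mem)
  from table_add[OF C(1) justified_rec_SucI[OF C(2)[unfolded prog_encode.simps] C(3)]]
  show ?case by auto
next
  case (mu p x n)
  \<comment> \<open>The finitely many tables for the arguments below \<open>n\<close> are merged one
    by one.\<close>
  have "\<exists>A. table A \<and> (\<forall>m<k. \<exists>v. mem A (prog_encode p) (pr x m) (Suc v))" if "k \<le> n" for k
    using that
  proof (induction k)
    case 0
    then show ?case using table_0 by blast
  next
    case (Suc k)
    then obtain A where A: "table A" "\<forall>m<k. \<exists>v. mem A (prog_encode p) (pr x m) (Suc v)" by auto
    from mu.IH Suc.prems obtain B v where B: "table B" "mem B (prog_encode p) (pr x k) (Suc v)"
      by (meson Suc_le_lessD)
    from table_union[OF A(1) B(1)] obtain C where C: "table C"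
      "set_decode A \<subseteq> set_decode C" "set_decode B \<subseteq> set_decode C" .
    have "\<exists>v. mem C (prog_encode p) (pr x m) (Suc v)" if "m < Suc k" for m
      using A(2) B(2) mem_mono[OF C(2)] mem_mono[OF C(3)] that by (metis less_Suc_eq)
    with C(1) show ?case by blast
  qed
  then obtain A where A: "table A" "\<forall>m<n. \<exists>v. mem A (prog_encode p) (pr x m) (Suc v)" by blast
  from mu.IH obtain B where B: "table B" "mem B (prog_encode p) (pr x n) 0" by blast
  from table_union[OF A(1) B(1)] obtain C where C: "table C"
    "set_decode A \<subseteq> set_decode C" "set_decode B \<subseteq> set_decode C" .
  have "\<exists>v. mem C (prog_encode p) (pr x m) (Suc v)" if "m < n" for m
    using A(2) mem_mono[OF C(2)] that by blast
  from table_add[OF C(1) justified_MuI[OF mem_mono[OF C(3) B(2)] this]] show ?case by auto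
qed

text \<open>Bounding the code of the table by \<open>w\<close> makes this a decidable approximation
  that increases with \<open>w\<close>. Only diagonal values are recorded, since H and the halting
  jump use no others.\<close>

definition conv :: "nat \<Rightarrow> nat \<Rightarrow> nat \<Rightarrow> bool" where
  "conv w x v \<longleftrightarrow> (\<exists>A\<le>w. table A \<and> mem A x x v)"

lemma decidable_conv [comp_intros]:
  assumes "computable w" "computable x" "computable v"
  shows "decidable (\<lambda>z. conv (w z) (x z) (v z))"
  unfolding conv_def
  by (intro comp_intros decidable_compose[OF decidable_table] assms
      computable_compose[OF assms(1)] computable_compose[OF assms(2)] computable_compose[OF assms(3)])

lemma conv_mono: "w \<le> w' \<Longrightarrow> conv w x v \<Longrightarrow> conv w' x v"
  unfolding conv_def using le_trans by blast

lemma prog_encode_decode [simp]: "prog_encode (prog_decode e) = e"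
  unfolding prog_decode_def by (simp add: surj_f_inv_f surj_prog_encode)

lemma prog_decode_encode [simp]: "prog_decode (prog_encode p) = p"
  unfolding prog_decode_def by (simp add: inj_prog_encode)

lemma phi_iff_conv: "phi x x = Some v \<longleftrightarrow> (\<exists>w. conv w x v)"
proof
  assume "phi x x = Some v"
  then have "computes (prog_decode x) x v" by (simp add: phi_eq_Some_iff)
  from table_complete[OF this] show "\<exists>w. conv w x v"
    unfolding conv_def by auto
next
  assume "\<exists>w. conv w x v"
  then obtain A where "table A" "mem A x x v" unfolding conv_def by blast
  then have "computes (prog_decode x) x v"
    using table_sound[of A "prog_decode x" x v] by simp
  then show "phi x x = Some v" by (simp add: phi_eq_Some_iff)
qed

lemma conv_functional: "conv w x v \<Longrightarrow> conv w' x v' \<Longrightarrow> v = v'"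
  using phi_iff_conv by (metis option.inject)

lemma conv_le: "conv w x v \<Longrightarrow> v \<le> w"
  unfolding conv_def using mem_le(3) le_trans by blast

section \<open>Stages of the ceer H\<close>

definition H_stage :: "nat \<Rightarrow> nat rel" where
  "H_stage w = {(x, y). x = y \<or> (\<exists>v\<le>w. conv w x v \<and> conv w y v)}"

lemma decidable_H_stage [comp_intros]:
  assumes "computable w" "computable x" "computable y"
  shows "decidable (\<lambda>z. (x z, y z) \<in> H_stage (w z))"
  unfolding H_stage_def mem_Collect_eq prod.case
  by (intro comp_intros assms
      computable_compose[OF assms(1)] computable_compose[OF assms(2)] computable_compose[OF assms(3)])

lemma H_stage_iff: "(x, y) \<in> H_stage w \<longleftrightarrow> x = y \<or> (\<exists>v. conv w x v \<and> conv w y v)"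
  unfolding H_stage_def using conv_le by blast

lemma H_stage_mono: "w \<le> w' \<Longrightarrow> H_stage w \<subseteq> H_stage w'"
  using conv_mono[of w w'] unfolding subset_iff split_paired_All H_stage_iff by blast

lemma equiv_H_stage: "equiv UNIV (H_stage w)"
  by (rule equivI) (auto simp: refl_on_def sym_def trans_def H_stage_iff dest: conv_functional)

lemma H_rel_eq: "H_rel = (\<Union>w. H_stage w)"
proof -
  have "(\<exists>v. phi x x = Some v \<and> phi y y = Some v) \<longleftrightarrow> (\<exists>w v. conv w x v \<and> conv w y v)" for x y
    unfolding phi_iff_conv by (meson conv_mono nle_le)
  then show ?thesis unfolding H_rel_def by (auto simp: H_stage_iff)
qed

section \<open>The structure of the omega jump\<close>

text \<open>The recursion collapses: column \<open>i\<close> is settled when stage \<open>i\<close>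
  is reached and merely copied afterwards.\<close>

lemma omega_stage_pr:
  "(pr x i, pr y j) \<in> omega_stage R n \<longleftrightarrow> pr x i = pr y j \<or>
    i = j \<and> i \<le> n \<and> (case i of 0 \<Rightarrow> (x, y) \<in> R | Suc m \<Rightarrow> (x, y) \<in> saturation_jump (omega_stage R m))"
proof (induction n)
  case 0
  show ?case by (auto split: nat.split)
next
  case (Suc n)
  show ?case
    unfolding omega_stage.simps mem_Collect_eq using Suc.IH
    by (auto simp: le_Suc_eq split: nat.splits)
qed

text \<open>So a stage is the whole jump cut off after column \<open>n\<close>, which allows stages
  to be replaced by \<open>omega_jump\<close>.\<close>

lemma omega_stage_iff:
  "(a, b) \<in> omega_stage R n \<longleftrightarrow> a = b \<or> ps a \<le> n \<and> (a, b) \<in> omega_jump R"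
proof -
  obtain x i y j where a: "a = pr x i" and b: "b = pr y j" by (meson pr_cases)
  show ?thesis unfolding a b omega_jump_def UN_iff omega_stage_pr ps_pr by auto
qed

lemma omega_jump_column: "(a, b) \<in> omega_jump R \<Longrightarrow> ps a = ps b"
proof -
  obtain x i y j where a: "a = pr x i" and b: "b = pr y j" by (meson pr_cases)
  show "(a, b) \<in> omega_jump R \<Longrightarrow> ps a = ps b"
    unfolding a b omega_jump_def UN_iff omega_stage_pr ps_pr by auto
qed

lemma omega_jump_0:
  "(pr x 0, pr y 0) \<in> omega_jump R \<longleftrightarrow> x = y \<or> (x, y) \<in> R"
  unfolding omega_jump_def UN_iff omega_stage_pr by auto

lemma omega_jump_saturation:
  "(pr x (Suc n), pr y (Suc n)) \<in> omega_jump R \<longleftrightarrow> (x, y) \<in> saturation_jump (omega_stage R n)"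
  unfolding omega_jump_def UN_iff omega_stage_pr by (auto simp: saturation_jump_def)

lemma equiv_omega_stage:
  assumes "equiv UNIV R"
  shows "equiv UNIV (omega_stage R n)"
proof (rule equivI)
  show "omega_stage R n \<subseteq> UNIV \<times> UNIV" by simp
  show "refl (omega_stage R n)" by (simp add: refl_on_def omega_stage_iff)
  have R: "sym R" "trans R" using assms by (auto elim: equivE)
  show "sym (omega_stage R n)"
  proof (rule symI)
    fix a b assume *: "(a, b) \<in> omega_stage R n"
    obtain x i y j where a: "a = pr x i" and b: "b = pr y j" by (meson pr_cases)
    show "(b, a) \<in> omega_stage R n"
      using * R(1) unfolding a b omega_stage_pr
      by (auto simp: saturation_jump_def split: nat.splits dest: symD)
  qed
  show "trans (omega_stage R n)"
  proof (rule transI)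
    fix a b c assume *: "(a, b) \<in> omega_stage R n" "(b, c) \<in> omega_stage R n"
    obtain x i y j z k where a: "a = pr x i" and b: "b = pr y j" and c: "c = pr z k"
      by (meson pr_cases)
    show "(a, c) \<in> omega_stage R n"
    proof (cases "a = b \<or> b = c")
      case True
      with * show ?thesis by auto
    next
      case False
      with * have eq: "i = j" "j = k" unfolding a b c omega_stage_pr by auto
      show ?thesis
        using * False transD[OF R(2), of x y z] unfolding a b c omega_stage_pr eq
        by (cases k) (auto simp: saturation_jump_def)
    qed
  qed
qed

text \<open>The condition that one step of the definition of the omega jump puts on a pair, with
  the relation on the elements of the coded sets given by \<open>B\<close>.\<close>

definition half :: "(nat \<Rightarrow> nat \<Rightarrow> bool) \<Rightarrow> nat \<Rightarrow> nat \<Rightarrow> bool" where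
  "half B a b \<longleftrightarrow> (\<forall>u\<le>a. u \<in> set_decode (pf a) \<longrightarrow>
    (\<exists>v\<le>b. v \<in> set_decode (pf b) \<and> (u = v \<or> ps u < ps a \<and> B u v)))"

definition matched :: "nat rel \<Rightarrow> (nat \<Rightarrow> nat \<Rightarrow> bool) \<Rightarrow> nat \<Rightarrow> nat \<Rightarrow> bool" where
  "matched R B a b \<longleftrightarrow> ps a = ps b \<and>
    (ps a = 0 \<and> (pf a, pf b) \<in> R \<or> ps a > 0 \<and> half B a b \<and> half (\<lambda>u v. B v u) b a)"

lemma element_less: "u \<in> set_decode (pf a) \<Longrightarrow> u < a"
  using set_decode_less[of u "pf a"] le_prod_encode_1[of "pf a" "ps a"] by simp

lemma half_iff: "half B a b \<longleftrightarrow>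
  (\<forall>u\<in>set_decode (pf a). \<exists>v\<in>set_decode (pf b). u = v \<or> ps u < ps a \<and> B u v)"
  unfolding half_def by (meson element_less less_imp_le)

lemma Image_eq_iff:
  assumes "equiv UNIV E"
  shows "E `` X = E `` Y \<longleftrightarrow> (\<forall>u\<in>X. \<exists>v\<in>Y. (u, v) \<in> E) \<and> (\<forall>v\<in>Y. \<exists>u\<in>X. (u, v) \<in> E)"
proof -
  have "refl E" "sym E" "trans E" using assms by (auto elim: equivE)
  then have E: "(u, u) \<in> E" "(u, v) \<in> E \<longleftrightarrow> (v, u) \<in> E"
    "(u, v) \<in> E \<Longrightarrow> (v, w) \<in> E \<Longrightarrow> (u, w) \<in> E" for u v w
    by (auto simp: refl_on_def dest: symD transD)
  show ?thesis
  proof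
    assume eq: "E `` X = E `` Y"
    have "\<exists>v\<in>Y. (u, v) \<in> E" if "u \<in> X" for u
    proof -
      have "u \<in> E `` Y" using eq E(1) that by blast
      then show ?thesis using E(2) by blast
    qed
    moreover have "\<exists>u\<in>X. (u, v) \<in> E" if "v \<in> Y" for v
    proof -
      have "v \<in> E `` X" using eq E(1) that by blast
      then show ?thesis by blast
    qed
    ultimately show "(\<forall>u\<in>X. \<exists>v\<in>Y. (u, v) \<in> E) \<and> (\<forall>v\<in>Y. \<exists>u\<in>X. (u, v) \<in> E)" by blast
  next
    assume "(\<forall>u\<in>X. \<exists>v\<in>Y. (u, v) \<in> E) \<and> (\<forall>v\<in>Y. \<exists>u\<in>X. (u, v) \<in> E)"
    then show "E `` X = E `` Y" using E(2,3) unfolding set_eq_iff Image_iff by meson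
  qed
qed

text \<open>A recursive description of the jump without stages. Elements have smaller codes than the
  set containing them, so it supports induction on codes.\<close>

lemma omega_jump_iff:
  assumes "equiv UNIV R"
  shows "(a, b) \<in> omega_jump R \<longleftrightarrow> matched R (\<lambda>u v. (u, v) \<in> omega_jump R) a b"
proof -
  obtain x i y j where a: "a = pr x i" and b: "b = pr y j" by (meson pr_cases)
  have refl: "(x, x) \<in> R" for x using assms by (auto elim: equivE simp: refl_on_def)
  show ?thesis
  proof (cases "i = j")
    case False
    then show ?thesis using omega_jump_column[of a b] by (auto simp: a b matched_def)
  next
    case True
    show ?thesis
    proof (cases i)
      case 0
      with True show ?thesis using refl by (auto simp: a b matched_def omega_jump_0)
    next
      case (Suc n)
      with True have ij: "i = Suc n" "j = Suc n" by simp_all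
      have 1: "(a, b) \<in> omega_jump R \<longleftrightarrow> omega_stage R n `` set_decode x = omega_stage R n `` set_decode y"
        by (simp add: a b ij omega_jump_saturation saturation_jump_def)
      \<comment> \<open>Stage \<open>n\<close> relates an element of a column beyond
        \<open>n\<close> only to itself; this is where \<open>u = v\<close> and the guard
        \<open>ps u < ps a\<close> in \<open>half\<close> come from.\<close>
      have 2: "(u, v) \<in> omega_stage R n \<longleftrightarrow> u = v \<or> ps u < ps a \<and> (u, v) \<in> omega_jump R" for u v
        by (simp add: a ij omega_stage_iff less_Suc_eq_le)
      have 3: "(u, v) \<in> omega_stage R n \<longleftrightarrow> v = u \<or> ps v < ps b \<and> (u, v) \<in> omega_jump R" for u v
        using omega_jump_column[of u v] by (auto simp: b ij omega_stage_iff less_Suc_eq_le)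
      have "(\<forall>u\<in>set_decode x. \<exists>v\<in>set_decode y. (u, v) \<in> omega_stage R n) \<longleftrightarrow>
          half (\<lambda>u v. (u, v) \<in> omega_jump R) a b"
        unfolding half_iff 2 by (simp add: a b)
      moreover have "(\<forall>v\<in>set_decode y. \<exists>u\<in>set_decode x. (u, v) \<in> omega_stage R n) \<longleftrightarrow>
          half (\<lambda>u v. (v, u) \<in> omega_jump R) b a"
        unfolding half_iff 3 by (simp add: a b)
      ultimately show ?thesis
        unfolding 1 Image_eq_iff[OF equiv_omega_stage[OF assms]] matched_def
        by (simp add: a b ij)
    qed
  qed
qed

section \<open>Monotonicity, bisimulations and continuity\<close>

lemma half_mono:
  assumes "half B a b"
    "\<And>u v. u \<in> set_decode (pf a) \<Longrightarrow> v \<in> set_decode (pf b) \<Longrightarrow> B u v \<Longrightarrow> C u v"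
  shows "half C a b"
  unfolding half_iff
proof
  fix u assume u: "u \<in> set_decode (pf a)"
  with assms(1) obtain v where "v \<in> set_decode (pf b)" "u = v \<or> ps u < ps a \<and> B u v"
    unfolding half_iff by blast
  with assms(2)[OF u, of v] show "\<exists>v\<in>set_decode (pf b). u = v \<or> ps u < ps a \<and> C u v" by blast
qed

text \<open>Only elements of the two sets, or the two atoms in column 0, are ever compared.
  Restricting the premises to them lets induction hypotheses on smaller codes discharge
  them.\<close>

lemma matched_mono:
  assumes "matched R B a b"
    "\<And>u v. ps a > 0 \<Longrightarrow> u \<in> set_decode (pf a) \<Longrightarrow> v \<in> set_decode (pf b) \<Longrightarrow> B u v \<Longrightarrow> C u v"
    "ps a = 0 \<Longrightarrow> (pf a, pf b) \<in> R \<Longrightarrow> (pf a, pf b) \<in> S"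
  shows "matched S C a b"
proof (cases "ps a = 0")
  case True
  with assms(1,3) show ?thesis unfolding matched_def by simp
next
  case False
  then have *: "half B a b" "half (\<lambda>u v. B v u) b a" "ps a = ps b"
    using assms(1) False unfolding matched_def by blast+
  have C: "C u v" if "u \<in> set_decode (pf a)" "v \<in> set_decode (pf b)" "B u v" for u v
    using assms(2)[OF _ that] False by blast
  have "half C a b" by (rule half_mono[OF *(1)]) (rule C)
  moreover have "half (\<lambda>u v. C v u) b a" by (rule half_mono[OF *(2)]) (rule C)
  moreover note *(3)
  ultimately show ?thesis using False unfolding matched_def by blast
qed

text \<open>A bisimulation principle: because codes decrease, a relation that justifies itself in
  one step is contained in the jump.\<close>

lemma matched_imp_omega_jump:
  assumes "equiv UNIV R" "\<And>a b. B a b \<Longrightarrow> matched R B a b"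
  shows "B a b \<Longrightarrow> (a, b) \<in> omega_jump R"
proof (induction a arbitrary: b rule: less_induct)
  case (less a)
  have "matched R (\<lambda>u v. (u, v) \<in> omega_jump R) a b"
  proof (rule matched_mono[OF assms(2)[OF less.prems]])
    show "(u, v) \<in> omega_jump R" if "u \<in> set_decode (pf a)" "B u v" for u v
      using less.IH[OF element_less[OF that(1)] that(2)] .
  qed
  then show ?case by (rule iffD2[OF omega_jump_iff[OF assms(1)]])
qed

lemma omega_jump_mono:
  assumes "equiv UNIV R" "equiv UNIV S" "R \<subseteq> S"
  shows "omega_jump R \<subseteq> omega_jump S"
proof
  fix p assume p: "p \<in> omega_jump R"
  obtain a b where ab: "p = (a, b)" by fastforce
  show "p \<in> omega_jump S"
    unfolding ab
  proof (rule matched_imp_omega_jump[OF assms(2), where B = "\<lambda>a b. (a, b) \<in> omega_jump R"])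
    show "(a, b) \<in> omega_jump R" using p ab by simp
    show "matched S (\<lambda>a b. (a, b) \<in> omega_jump R) a b" if "(a, b) \<in> omega_jump R" for a b
      by (rule matched_mono[OF iffD1[OF omega_jump_iff[OF assms(1)] that]]) (use assms(3) in auto)
  qed
qed

lemma omega_jump_sym:
  assumes "equiv UNIV R" "(a, b) \<in> omega_jump R"
  shows "(b, a) \<in> omega_jump R"
proof -
  from assms(2) obtain n where "(a, b) \<in> omega_stage R n" unfolding omega_jump_def by blast
  with equiv_omega_stage[OF assms(1), of n] have "(b, a) \<in> omega_stage R n" by (meson equivE symD)
  then show ?thesis unfolding omega_jump_def by blast
qed

text \<open>Coded sets are finite, so an equivalence between them rests on finitely many
  equivalences of elements, each of which holds from some stage on.\<close>

lemma omega_jump_continuous: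
  assumes "\<And>w. equiv UNIV (R w)" "mono R" "equiv UNIV (\<Union>w::nat. R w)"
  shows "(a, b) \<in> omega_jump (\<Union>w. R w) \<Longrightarrow> \<forall>\<^sub>F w in sequentially. (a, b) \<in> omega_jump (R w)"
proof (induction a arbitrary: b rule: less_induct)
  case (less a)
  let ?J = "\<lambda>w u v. (u, v) \<in> omega_jump (R w)"
  have m: "matched (\<Union>w. R w) (\<lambda>u v. (u, v) \<in> omega_jump (\<Union>w. R w)) a b"
    using less.prems by (rule iffD1[OF omega_jump_iff[OF assms(3)]])
  have ab: "ps a = ps b" using m unfolding matched_def by blast
  have "\<forall>\<^sub>F w in sequentially. matched (R w) (?J w) a b"
  proof (cases "ps a = 0")
    case True
    with m obtain w where w: "(pf a, pf b) \<in> R w" unfolding matched_def by auto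
    have "matched (R w') (?J w') a b" if "w \<le> w'" for w'
      using w monoD[OF assms(2) that] True ab unfolding matched_def by auto
    then show ?thesis unfolding eventually_sequentially by blast
  next
    case False
    have "\<forall>u\<in>set_decode (pf a). \<forall>\<^sub>F w in sequentially.
        \<exists>v\<in>set_decode (pf b). u = v \<or> ps u < ps a \<and> ?J w u v"
    proof
      fix u assume u: "u \<in> set_decode (pf a)"
      with m False obtain v where v: "v \<in> set_decode (pf b)"
        "u = v \<or> ps u < ps a \<and> (u, v) \<in> omega_jump (\<Union>w. R w)"
        unfolding matched_def half_iff by blast
      from v(2) have "u = v \<or> ps u < ps a \<and> (\<forall>\<^sub>F w in sequentially. ?J w u v)"
        using less.IH[OF element_less[OF u]] by blast
      then have "\<forall>\<^sub>F w in sequentially. u = v \<or> ps u < ps a \<and> ?J w u v"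
        by (auto elim: eventually_mono)
      then show "\<forall>\<^sub>F w in sequentially. \<exists>v\<in>set_decode (pf b). u = v \<or> ps u < ps a \<and> ?J w u v"
        by (rule eventually_mono) (use v(1) in blast)
    qed
    then have 1: "\<forall>\<^sub>F w in sequentially. half (?J w) a b"
      unfolding half_iff by (intro eventually_ball_finite) auto
    have "\<forall>v\<in>set_decode (pf b). \<forall>\<^sub>F w in sequentially.
        \<exists>u\<in>set_decode (pf a). v = u \<or> ps v < ps b \<and> ?J w u v"
    proof
      fix v assume v: "v \<in> set_decode (pf b)"
      with m False obtain u where u: "u \<in> set_decode (pf a)"
        "v = u \<or> ps v < ps b \<and> (u, v) \<in> omega_jump (\<Union>w. R w)"
        unfolding matched_def half_iff by blast
      from u(2) have "v = u \<or> ps v < ps b \<and> (\<forall>\<^sub>F w in sequentially. ?J w u v)"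
        using less.IH[OF element_less[OF u(1)]] by blast
      then have "\<forall>\<^sub>F w in sequentially. v = u \<or> ps v < ps b \<and> ?J w u v"
        by (auto elim: eventually_mono)
      then show "\<forall>\<^sub>F w in sequentially. \<exists>u\<in>set_decode (pf a). v = u \<or> ps v < ps b \<and> ?J w u v"
        by (rule eventually_mono) (use u(1) in blast)
    qed
    then have 2: "\<forall>\<^sub>F w in sequentially. half (\<lambda>v u. ?J w u v) b a"
      unfolding half_iff by (intro eventually_ball_finite) auto
    from 1 2 show ?thesis
      by eventually_elim (use False ab in \<open>auto simp: matched_def\<close>)
  qed
  then show ?case
    by (rule eventually_mono) (rule iffD2[OF omega_jump_iff[OF assms(1)]])
qed

section \<open>Stage approximations to the omega jump of H\<close>

abbreviation J_stage :: "nat \<Rightarrow> nat \<Rightarrow> nat \<Rightarrow> bool" where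
  "J_stage w a b \<equiv> (a, b) \<in> omega_jump (H_stage w)"

lemma equiv_H_rel: "equiv UNIV H_rel"
  by (rule equivI) (auto simp: refl_on_def sym_def trans_def H_rel_def)

lemma J_stage_mono: "w \<le> w' \<Longrightarrow> J_stage w a b \<Longrightarrow> J_stage w' a b"
  using omega_jump_mono[OF equiv_H_stage equiv_H_stage H_stage_mono] by blast

lemma J_stage_imp: "J_stage w a b \<Longrightarrow> (a, b) \<in> omega_jump H_rel"
  using omega_jump_mono[OF equiv_H_stage equiv_H_rel, of w] H_rel_eq by blast

lemma eventually_J_stage:
  "(a, b) \<in> omega_jump H_rel \<Longrightarrow> \<forall>\<^sub>F w in sequentially. J_stage w a b"
  using omega_jump_continuous[of H_stage a b] equiv_H_stage equiv_H_rel
  by (simp add: H_rel_eq[symmetric] monoI H_stage_mono)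

section \<open>Decidability of the stages\<close>

lemma pr_mono: "a \<le> c \<Longrightarrow> b \<le> d \<Longrightarrow> pr a b \<le> pr c d"
  unfolding prod_encode_def triangle_def
  by (simp, intro add_mono div_le_mono mult_le_mono) auto

lemma set_encode_bound:
  assumes "X \<subseteq> {..n}"
  shows "set_encode X \<le> 2 ^ Suc n"
proof -
  have "finite X" using assms finite_subset by blast
  then have "set_encode X = sum ((^) 2) X" by (simp add: set_encode_def)
  also have "\<dots> \<le> sum ((^) 2) {..n}" using assms by (intro sum_mono2) auto
  also have "\<dots> \<le> 2 ^ Suc n" by (induction n) auto
  finally show ?thesis .
qed

text \<open>A certificate is a finite bisimulation coded as a set of pairs; a bounded search for one
  decides \<open>J_stage\<close>.\<close>

definition certificate :: "nat \<Rightarrow> nat \<Rightarrow> bool" where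
  "certificate w B \<longleftrightarrow> (\<forall>a\<le>B. \<forall>b\<le>B. pr a b \<in> set_decode B \<longrightarrow>
    matched (H_stage w) (\<lambda>u v. pr u v \<in> set_decode B) a b)"

text \<open>The jump restricted to numbers up to \<open>a + b\<close> is itself a certificate, since
  it contains the pairs of smaller elements that justify its members. This bounds the
  search.\<close>

lemma J_stage_iff_certificate:
  "J_stage w a b \<longleftrightarrow>
    (\<exists>B\<le>2 ^ Suc (pr (a + b) (a + b)). certificate w B \<and> pr a b \<in> set_decode B)"
proof
  assume "\<exists>B\<le>2 ^ Suc (pr (a + b) (a + b)). certificate w B \<and> pr a b \<in> set_decode B"
  then obtain B where B: "certificate w B" "pr a b \<in> set_decode B" by blast
  show "J_stage w a b"
  proof (rule matched_imp_omega_jump[OF equiv_H_stage, where B = "\<lambda>u v. pr u v \<in> set_decode B"])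
    show "pr a b \<in> set_decode B" by (rule B)
    fix a b assume ab: "pr a b \<in> set_decode B"
    have "a \<le> B" "b \<le> B"
      using set_decode_less[OF ab] le_prod_encode_1[of a b] le_prod_encode_2[of b a] by linarith+
    with ab B(1) show "matched (H_stage w) (\<lambda>u v. pr u v \<in> set_decode B) a b"
      unfolding certificate_def by blast
  qed
next
  assume J: "J_stage w a b"
  let ?m = "a + b"
  define X where "X = {pr u v | u v. u \<le> ?m \<and> v \<le> ?m \<and> J_stage w u v}"
  have sub: "X \<subseteq> {..pr ?m ?m}" unfolding X_def using pr_mono by auto
  have X: "set_decode (set_encode X) = X"
    using finite_subset[OF sub] by simp
  have iff: "pr u v \<in> X \<longleftrightarrow> u \<le> ?m \<and> v \<le> ?m \<and> J_stage w u v" for u v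
    unfolding X_def by auto
  have "matched (H_stage w) (\<lambda>u v. pr u v \<in> X) a' b'" if "pr a' b' \<in> X" for a' b'
  proof -
    have le: "a' \<le> ?m" "b' \<le> ?m" and "J_stage w a' b'" using that iff by auto
    from iffD1[OF omega_jump_iff[OF equiv_H_stage] this(3)] show ?thesis
    proof (rule matched_mono)
      fix u v assume "u \<in> set_decode (pf a')" "v \<in> set_decode (pf b')" "J_stage w u v"
      then show "pr u v \<in> X"
        using element_less[of u a'] element_less[of v b'] le by (simp add: iff)
    qed
  qed
  then have "certificate w (set_encode X)"
    unfolding certificate_def X by blast
  moreover have "pr a b \<in> set_decode (set_encode X)" using J X iff by simp
  ultimately show "\<exists>B\<le>2 ^ Suc (pr ?m ?m). certificate w B \<and> pr a b \<in> set_decode B"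
    using set_encode_bound[OF sub] by blast
qed

lemma decidable_certificate: "decidable (\<lambda>z. certificate (pf z) (ps z))"
  unfolding certificate_def matched_def half_def by (intro comp_intros)

lemma decidable_J_stage [comp_intros]:
  assumes "computable w" "computable a" "computable b"
  shows "decidable (\<lambda>z. J_stage (w z) (a z) (b z))"
proof -
  have c: "decidable (\<lambda>z. certificate (f z) (g z))" if "computable f" "computable g" for f g
    using decidable_compose[OF decidable_certificate computable_pr[OF that]]
    unfolding pf_pr ps_pr .
  show ?thesis
    unfolding J_stage_iff_certificate
    by (intro comp_intros c assms computable_compose[OF assms(1)] computable_compose[OF assms(2)]
        computable_compose[OF assms(3)])
qed

section \<open>Supports\<close>

text \<open>All elements are unfolded down to their atoms, including those in columns so high that
  the jump compares them only by equality.\<close>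

function supp :: "nat \<Rightarrow> nat set" where
  "supp a = (if ps a = 0 then {pf a} else (\<Union>u\<in>set_decode (pf a). supp u))"
  by auto
termination by (relation "measure id") (auto intro: element_less)

declare supp.simps [simp del]

lemma pf_le: "pf a \<le> a"
  using le_prod_encode_1[of "pf a" "ps a"] by (simp only: pr_pf_ps)

lemma supp_0: "ps a = 0 \<Longrightarrow> supp a = {pf a}"
  by (subst supp.simps) simp

lemma supp_Suc: "ps a > 0 \<Longrightarrow> supp a = (\<Union>u\<in>set_decode (pf a). supp u)"
  by (subst supp.simps) simp

lemma supp_le: "u \<in> supp a \<Longrightarrow> u \<le> a"
proof (induction a rule: less_induct)
  case (less a)
  show ?case
  proof (cases "ps a = 0")
    case True
    then show ?thesis using less.prems pf_le by (simp add: supp_0)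
  next
    case False
    with less.prems obtain b where "b \<in> set_decode (pf a)" "u \<in> supp b"
      by (auto simp: supp_Suc)
    with less.IH[OF element_less] element_less show ?thesis by (meson le_trans less_imp_le)
  qed
qed

lemma finite_supp [simp]: "finite (supp a)"
  using supp_le finite_subset[of "supp a" "{..a}"] by auto

definition hereditary :: "nat \<Rightarrow> bool" where
  "hereditary B \<longleftrightarrow> (\<forall>b\<le>B. b \<in> set_decode B \<and> 0 < ps b \<longrightarrow>
    (\<forall>u\<le>b. u \<in> set_decode (pf b) \<longrightarrow> u \<in> set_decode B))"

lemma hereditary_iff:
  "hereditary B \<longleftrightarrow> (\<forall>b\<in>set_decode B. 0 < ps b \<longrightarrow> set_decode (pf b) \<subseteq> set_decode B)"
  unfolding hereditary_def subset_iff using set_decode_less element_less less_imp_le by meson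

text \<open>The support consists of the atoms that every element-closed set around \<open>a\<close>
  must contain. The closed set witnessing the converse has only members up to \<open>a\<close>,
  hence the bound.\<close>

lemma supp_iff_hereditary:
  "u \<in> supp a \<longleftrightarrow> (\<forall>B\<le>2 ^ Suc a. a \<in> set_decode B \<and> hereditary B \<longrightarrow> pr u 0 \<in> set_decode B)"
proof
  have "u \<in> supp a \<Longrightarrow> a \<in> set_decode B \<Longrightarrow> hereditary B \<Longrightarrow> pr u 0 \<in> set_decode B" for B
  proof (induction a rule: less_induct)
    case (less a)
    show ?case
    proof (cases "ps a = 0")
      case True
      with less.prems(1) have "pr u 0 = a" by (simp add: supp_0) (metis True pr_pf_ps)
      with less.prems(2) show ?thesis by simp
    next
      case False
      with less.prems(1) obtain b where b: "b \<in> set_decode (pf a)" "u \<in> supp b"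
        by (auto simp: supp_Suc)
      have "b \<in> set_decode B"
        using less.prems(2,3) False b(1) unfolding hereditary_iff by blast
      with less.IH[OF element_less[OF b(1)] b(2)] less.prems(3) show ?thesis by blast
    qed
  qed
  then show "u \<in> supp a \<Longrightarrow>
      \<forall>B\<le>2 ^ Suc a. a \<in> set_decode B \<and> hereditary B \<longrightarrow> pr u 0 \<in> set_decode B" by blast
next
  assume *: "\<forall>B\<le>2 ^ Suc a. a \<in> set_decode B \<and> hereditary B \<longrightarrow> pr u 0 \<in> set_decode B"
  define X where "X = {b. b \<le> a \<and> supp b \<subseteq> supp a}"
  have sub: "X \<subseteq> {..a}" unfolding X_def by auto
  have X: "set_decode (set_encode X) = X"
    using finite_subset[OF sub] by simp
  have "set_decode (pf b) \<subseteq> X" if "b \<in> X" "0 < ps b" for b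
  proof
    fix c assume c: "c \<in> set_decode (pf b)"
    then have "supp c \<subseteq> supp b" using that(2) by (auto simp: supp_Suc)
    then show "c \<in> X" using that(1) element_less[OF c] unfolding X_def by auto
  qed
  then have "hereditary (set_encode X)" unfolding hereditary_iff X by blast
  moreover have "a \<in> set_decode (set_encode X)" unfolding X by (simp add: X_def)
  ultimately have "pr u 0 \<in> X" using * set_encode_bound[OF sub] X by blast
  then show "u \<in> supp a" unfolding X_def by (simp add: supp_0)
qed

lemma decidable_supp [comp_intros]:
  assumes "computable u" "computable a"
  shows "decidable (\<lambda>z. u z \<in> supp (a z))"
proof -
  have "decidable hereditary"
    unfolding hereditary_def by (intro comp_intros)
  note h = decidable_compose[OF this]
  show ?thesis
    unfolding supp_iff_hereditary
    by (intro comp_intros h assms computable_compose[OF assms(1)] computable_compose[OF assms(2)])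
qed

section \<open>Atoms that have not converged\<close>

definition live :: "nat \<Rightarrow> nat \<Rightarrow> nat set" where
  "live w a = {u \<in> supp a. \<forall>v. \<not> conv w u v}"

text \<open>An element that has not converged is equivalent to itself only, so it cannot disappear
  from a hereditarily finite set without changing its class.\<close>

lemma J_stage_live_subset: "J_stage w a b \<Longrightarrow> live w a \<subseteq> live w b"
proof (induction a arbitrary: b rule: less_induct)
  case (less a)
  have m: "matched (H_stage w) (J_stage w) a b"
    using less.prems by (rule iffD1[OF omega_jump_iff[OF equiv_H_stage]])
  show ?case
  proof (cases "ps a = 0")
    case True
    with m have "ps b = 0" "(pf a, pf b) \<in> H_stage w" unfolding matched_def by auto
    with True show ?thesis by (auto simp: live_def supp_0 H_stage_iff)
  next
    case False
    show ?thesis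
    proof
      fix x assume x: "x \<in> live w a"
      then obtain u where u: "u \<in> set_decode (pf a)" "x \<in> live w u"
        using False by (auto simp: live_def supp_Suc)
      from m False u(1) obtain v where v: "v \<in> set_decode (pf b)" "u = v \<or> J_stage w u v"
        unfolding matched_def half_iff by blast
      have "x \<in> live w v"
        using v(2) u(2) less.IH[OF element_less[OF u(1)]] by blast
      moreover have "0 < ps b" using m False unfolding matched_def by auto
      ultimately show "x \<in> live w b"
        using v(1) by (auto simp: live_def supp_Suc)
    qed
  qed
qed

lemma J_stage_live: "J_stage w a b \<Longrightarrow> live w a = live w b"
  using J_stage_live_subset omega_jump_sym[OF equiv_H_stage] by blast

text \<open>Unfolding an equivalence of two sets consults \<open>R\<close> only at pairs of atoms
  from their supports.\<close>

lemma omega_jump_transfer: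
  assumes "equiv UNIV R" "equiv UNIV S"
  shows "(a, b) \<in> omega_jump R \<Longrightarrow> (\<And>u v. u \<in> supp a \<Longrightarrow> v \<in> supp b \<Longrightarrow> (u, v) \<in> R \<Longrightarrow> (u, v) \<in> S) \<Longrightarrow>
    (a, b) \<in> omega_jump S"
proof (induction a arbitrary: b rule: less_induct)
  case (less a)
  have m: "matched R (\<lambda>u v. (u, v) \<in> omega_jump R) a b"
    using less.prems(1) by (rule iffD1[OF omega_jump_iff[OF assms(1)]])
  then have ab: "ps a = ps b" unfolding matched_def by blast
  from m have "matched S (\<lambda>u v. (u, v) \<in> omega_jump S) a b"
  proof (rule matched_mono)
    assume "ps a = 0" "(pf a, pf b) \<in> R"
    then show "(pf a, pf b) \<in> S" using less.prems(2) ab by (simp add: supp_0)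
  next
    fix u v assume *: "0 < ps a" "u \<in> set_decode (pf a)" "v \<in> set_decode (pf b)" "(u, v) \<in> omega_jump R"
    have "supp u \<subseteq> supp a" "supp v \<subseteq> supp b" using * ab by (auto simp: supp_Suc)
    then show "(u, v) \<in> omega_jump S"
      using less.IH[OF element_less[OF *(2)] *(4)] less.prems(2) by blast
  qed
  then show ?case by (rule iffD2[OF omega_jump_iff[OF assms(2)]])
qed

text \<open>Atoms of the two supports outside \<open>D\<close> have already converged at
  \<open>w\<close>, and those in \<open>D\<close> gain no value by \<open>w'\<close>, so the later
  stage knows nothing new about them. Used contrapositively: a new equivalence forces an atom of
  \<open>D\<close> to converge.\<close>

lemma J_stage_frozen:
  assumes "w \<le> w'" "J_stage w' a b" "live w a \<subseteq> D" "live w b \<subseteq> D"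
    "\<And>u v. u \<in> D \<Longrightarrow> conv w' u v \<Longrightarrow> conv w u v"
  shows "J_stage w a b"
proof (rule omega_jump_transfer[OF equiv_H_stage equiv_H_stage assms(2)])
  have conv_back: "conv w u v" if *: "conv w' u v" "u \<in> supp a \<or> u \<in> supp b" for u v
  proof (cases "u \<in> D")
    case True
    then show ?thesis using assms(5) *(1) by blast
  next
    case False
    then obtain v' where "conv w u v'" using *(2) assms(3,4) unfolding live_def by blast
    moreover from this have "v' = v" using *(1) conv_functional by blast
    ultimately show ?thesis by simp
  qed
  fix u v assume "u \<in> supp a" "v \<in> supp b" "(u, v) \<in> H_stage w'"
  then show "(u, v) \<in> H_stage w" using conv_back unfolding H_stage_iff by blast
qed

section \<open>The combinatorial core\<close>

text \<open>Describes which tokens are equivalent once the names \<open>2 i\<close> and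
  \<open>2 i + 1\<close> have been identified for all \<open>i < k\<close>.\<close>

definition related :: "(nat \<Rightarrow> nat) \<Rightarrow> nat \<Rightarrow> nat \<Rightarrow> nat \<Rightarrow> bool" where
  "related nm k i j \<longleftrightarrow> nm i = nm j \<or> nm i div 2 = nm j div 2 \<and> nm i div 2 < k"

text \<open>Token \<open>j\<close> carries the name \<open>nm j\<close> and is mapped to \<open>g j\<close> by the reduction. The test for
  \<open>k\<close> says that at stage \<open>w\<close> the opponent has answered the identification of the names \<open>2 i\<close>
  and \<open>2 i + 1\<close> for all \<open>i < k\<close>, and has not yet identified \<open>2 k\<close> and \<open>2 k + 1\<close>.\<close>

definition test :: "(nat \<Rightarrow> nat) \<Rightarrow> (nat \<Rightarrow> nat) \<Rightarrow> nat \<Rightarrow> nat \<Rightarrow> nat \<Rightarrow> bool" where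
  "test g nm c w k \<longleftrightarrow>
    (\<forall>i\<le>c. \<forall>j\<le>c. related nm k i j \<longrightarrow> J_stage w (g i) (g j)) \<and>
    (\<exists>i\<le>c. \<exists>j\<le>c. related nm (Suc k) i j \<and> \<not> J_stage w (g i) (g j))"

text \<open>The identification of \<open>0\<close> with \<open>z\<close> and of \<open>p\<close> with \<open>q\<close> leaves only elements of
  \<open>supp (g 0)\<close> alive in \<open>g p\<close>. As \<open>supp (g 0)\<close> has at most \<open>g 0 + 1\<close> elements, \<open>g 0 + 3\<close> pairs
  of names suffice for the contradiction.\<close>

definition good :: "(nat \<Rightarrow> nat) \<Rightarrow> (nat \<Rightarrow> nat) \<Rightarrow> nat \<Rightarrow> bool" where
  "good g nm c \<longleftrightarrow> (\<exists>z\<le>c. nm 0 = nm z \<and> (\<forall>i<2 * (g 0 + 3). \<exists>p\<le>c. \<exists>q\<le>c.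
    nm p = i \<and> nm q = i \<and>
    (\<forall>u\<le>g p. u \<in> supp (g p) \<and> u \<in> supp (g q) \<longrightarrow> u \<in> supp (g 0) \<or> u \<in> supp (g z))))"

text \<open>\<open>red\<close> is the reduction property as seen by the tokens: the two names of
  pair \<open>k\<close> are identified exactly if the test for \<open>k\<close> succeeds at some
  stage. All \<open>L\<close> tests succeed, and from each to the next a further atom of
  \<open>D\<close> converges.\<close>

lemma good_contradiction:
  assumes good: "good g nm c"
    and red: "\<And>i j. (g i, g j) \<in> omega_jump H_rel \<longleftrightarrow>
      nm i = nm j \<or> nm i div 2 = nm j div 2 \<and> (\<exists>w. test g nm c w (nm i div 2))"
  shows False
proof -
  define L where "L = g 0 + 3"
  define D where "D = supp (g 0)"
  from good obtain z where z: "z \<le> c" "nm 0 = nm z"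
    and pq: "\<And>i. i < 2 * L \<Longrightarrow> \<exists>p\<le>c. \<exists>q\<le>c. nm p = i \<and> nm q = i \<and>
      supp (g p) \<inter> supp (g q) \<subseteq> D \<union> supp (g z)"
    unfolding good_def L_def D_def subset_iff Int_iff Un_iff using supp_le by meson
  \<comment> \<open>Once the tests below \<open>k\<close> have succeeded, \<open>red\<close> and
    finiteness give a stage at which all tokens up to \<open>c\<close> related at level
    \<open>k\<close> agree. If the test for \<open>k\<close> failed even there, the names
    \<open>2 k\<close> and \<open>2 k + 1\<close> would already be equivalent, which by
    \<open>red\<close> requires its success.\<close>
  have tests: "k < L \<Longrightarrow> \<exists>w. test g nm c w k" for k
  proof (induction k rule: less_induct)
    case (less k)
    have "(g i, g j) \<in> omega_jump H_rel" if "related nm k i j" for i j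
      using that less.IH less.prems unfolding red related_def by (meson less_trans)
    then have "\<forall>\<^sub>F w in sequentially. related nm k i j \<longrightarrow> J_stage w (g i) (g j)" for i j
      by (cases "related nm k i j") (auto intro: eventually_J_stage)
    then have "\<forall>\<^sub>F w in sequentially. \<forall>i\<in>{..c}. \<forall>j\<in>{..c}. related nm k i j \<longrightarrow> J_stage w (g i) (g j)"
      by (intro eventually_ball_finite ballI) auto
    then obtain w where w: "\<And>i j. i \<le> c \<Longrightarrow> j \<le> c \<Longrightarrow> related nm k i j \<Longrightarrow> J_stage w (g i) (g j)"
      unfolding eventually_sequentially by auto
    show ?case
    proof (rule ccontr)
      assume no: "\<nexists>w. test g nm c w k"
      obtain p q where p: "p \<le> c" "nm p = 2 * k" and q: "q \<le> c" "nm q = 2 * k + 1"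
        using pq[of "2 * k"] pq[of "2 * k + 1"] less.prems by auto
      have rel: "related nm (Suc k) p q" using p q by (simp add: related_def)
      have "J_stage w (g p) (g q)"
        using no w p(1) q(1) rel unfolding test_def by blast
      from J_stage_imp[OF this] no p(2) q(2) show False unfolding red by simp
    qed
  qed
  then obtain W where W: "\<And>k. k < L \<Longrightarrow> test g nm c (W k) k" by metis
  define C where "C k = {u \<in> D. \<exists>v. conv (W k) u v}" for k
  have step: "C k \<subset> C (Suc k)" if "Suc k < L" for k
  proof -
    have k: "test g nm c (W k) k" and Sk: "test g nm c (W (Suc k)) (Suc k)"
      using W that by simp_all
    have J: "J_stage (W k) (g i) (g j)" if "i \<le> c" "j \<le> c" "nm i = nm j" for i j
      using k that unfolding test_def related_def by blast
    from k obtain i j where ij: "i \<le> c" "j \<le> c" "related nm (Suc k) i j" "\<not> J_stage (W k) (g i) (g j)"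
      unfolding test_def by blast
    have J': "J_stage (W (Suc k)) (g i) (g j)"
      using Sk ij(1-3) unfolding test_def by blast
    \<comment> \<open>The stages were chosen independently; a pair that is equivalent at
      \<open>W (Suc k)\<close> but not at \<open>W k\<close> fixes their order.\<close>
    have lt: "W k \<le> W (Suc k)"
      using J_stage_mono[of "W (Suc k)" "W k"] J' ij(4) by (meson nle_le)
    have "\<not> related nm k i j" using k ij unfolding test_def by blast
    with ij(3) have nm: "nm i div 2 = k" "nm j div 2 = k" unfolding related_def by auto
    \<comment> \<open>Tokens with equal names have the same live atoms. Those of \<open>g a\<close>
      therefore lie in \<open>g p\<close> and in \<open>g q\<close>, hence in \<open>D\<close> or in
      \<open>g z\<close>, and the live atoms of \<open>g z\<close> are those of
      \<open>g 0\<close>.\<close>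
    have live: "live (W k) (g a) \<subseteq> D" if a: "a \<le> c" "nm a div 2 = k" for a
    proof
      fix u assume u: "u \<in> live (W k) (g a)"
      have "nm a < 2 * L" using a(2) \<open>Suc k < L\<close> by linarith
      from pq[OF this] obtain p q where p: "p \<le> c" "nm p = nm a" and q: "q \<le> c" "nm q = nm a"
        and sub: "supp (g p) \<inter> supp (g q) \<subseteq> D \<union> supp (g z)" by blast
      have "u \<in> live (W k) (g p)" "u \<in> live (W k) (g q)"
        using u J_stage_live[OF J[OF a(1) p(1)]] J_stage_live[OF J[OF a(1) q(1)]] p(2) q(2) by auto
      with sub have "u \<in> D \<or> u \<in> live (W k) (g z)" unfolding live_def by blast
      moreover have "live (W k) (g z) = live (W k) (g 0)"
        using J_stage_live[OF J[OF z(1) _ z(2)[symmetric]]] by simp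
      ultimately show "u \<in> D" unfolding D_def live_def by auto
    qed
    have "C k \<subseteq> C (Suc k)" unfolding C_def using conv_mono[OF lt] by blast
    \<comment> \<open>Had no atom of \<open>D\<close> converged in between,
      \<open>J_stage_frozen\<close> would carry the equivalence of \<open>g i\<close> and
      \<open>g j\<close> back to stage \<open>W k\<close>.\<close>
    moreover have "C k \<noteq> C (Suc k)"
    proof
      assume eq: "C k = C (Suc k)"
      have "conv (W k) u v" if u: "u \<in> D" "conv (W (Suc k)) u v" for u v
      proof -
        have "u \<in> C k" unfolding eq using u by (auto simp: C_def)
        then obtain v' where "conv (W k) u v'" by (auto simp: C_def)
        with conv_functional[OF this u(2)] show ?thesis by simp
      qed
      from J_stage_frozen[OF lt J' live[OF ij(1) nm(1)] live[OF ij(2) nm(2)] this] ij(4)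
      show False by blast
    qed
    ultimately show ?thesis by blast
  qed
  have fin: "finite D" "card D \<le> g 0 + 1"
    unfolding D_def using supp_le card_mono[of "{..g 0}" "supp (g 0)"] by auto
  have "k < L \<Longrightarrow> k \<le> card (C k)" for k
  proof (induction k)
    case (Suc k)
    have "finite (C (Suc k))" unfolding C_def using fin by simp
    from psubset_card_mono[OF this step[OF Suc.prems]] Suc show ?case by simp
  qed simp
  from this[of "g 0 + 2"] have "g 0 + 2 \<le> card (C (g 0 + 2))" by (simp add: L_def)
  moreover have "card (C (g 0 + 2)) \<le> card D"
    using fin by (intro card_mono) (auto simp: C_def)
  ultimately show False using fin by simp
qed

text \<open>With \<open>p\<close> fixed, \<open>S p \<inter> S z\<close> takes finitely many values,
  so infinitely many \<open>z\<close> share one. One of these becomes \<open>q\<close>, the others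
  form the new reservoir, from which all later pairs are drawn.\<close>

lemma disjoint_pairs:
  fixes S :: "nat \<Rightarrow> nat set"
  assumes "\<And>j. finite (S j)" "infinite Z"
  shows "\<exists>(nm :: nat \<Rightarrow> nat) J Z'. finite J \<and> J \<subseteq> Z \<and> infinite Z' \<and> Z' \<subseteq> Z - J \<and>
    (\<forall>i<M. \<exists>p\<in>J. \<exists>q\<in>J. nm p = i \<and> nm q = i \<and> (\<forall>z\<in>Z'. S p \<inter> S q \<subseteq> S z))"
proof (induction M)
  case 0
  show ?case using assms(2) by (intro exI[of _ id] exI[of _ "{}"] exI[of _ Z]) auto
next
  case (Suc M)
  then obtain nm J Z' where IH: "finite J" "J \<subseteq> Z" "infinite Z'" "Z' \<subseteq> Z - J"
    "\<And>i. i < M \<Longrightarrow> \<exists>p\<in>J. \<exists>q\<in>J. nm p = i \<and> nm q = i \<and> (\<forall>z\<in>Z'. S p \<inter> S q \<subseteq> S z)"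
    by blast
  obtain p where p: "p \<in> Z'" using infinite_imp_nonempty[OF IH(3)] by blast
  have "finite ((\<lambda>z. S p \<inter> S z) ` (Z' - {p}))"
    by (rule finite_subset[of _ "Pow (S p)"]) (use assms(1) in auto)
  with IH(3) obtain q where q: "q \<in> Z' - {p}" "infinite {z \<in> Z' - {p}. S p \<inter> S z = S p \<inter> S q}"
    using pigeonhole_infinite[of "Z' - {p}" "\<lambda>z. S p \<inter> S z"] by auto
  define Z'' where "Z'' = {z \<in> Z' - {p}. S p \<inter> S z = S p \<inter> S q} - {q}"
  define nm' where "nm' = nm(p := M, q := M)"
  have "infinite Z''" unfolding Z''_def using q(2) by simp
  moreover have "Z'' \<subseteq> Z - (J \<union> {p, q})" using IH(4) by (auto simp: Z''_def)
  moreover have "\<exists>a\<in>J \<union> {p, q}. \<exists>b\<in>J \<union> {p, q}. nm' a = i \<and> nm' b = i \<and> (\<forall>z\<in>Z''. S a \<inter> S b \<subseteq> S z)"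
    if "i < Suc M" for i
  proof (cases "i = M")
    case True
    have "nm' p = M" "nm' q = M" by (simp_all add: nm'_def)
    moreover have "\<forall>z\<in>Z''. S p \<inter> S q \<subseteq> S z" unfolding Z''_def by blast
    ultimately show ?thesis using True by blast
  next
    case False
    then have "i < M" using that by simp
    from IH(5)[OF this] obtain a b where ab: "a \<in> J" "b \<in> J" "nm a = i" "nm b = i"
      "\<forall>z\<in>Z'. S a \<inter> S b \<subseteq> S z" by blast
    have "nm' a = i" "nm' b = i" using ab p q(1) IH(4) by (auto simp: nm'_def)
    moreover have "Z'' \<subseteq> Z'" unfolding Z''_def by blast
    ultimately show ?thesis using ab by blast
  qed
  moreover have "finite (J \<union> {p, q})" "J \<union> {p, q} \<subseteq> Z" using IH p q by auto
  ultimately show ?case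
    by (intro exI[of _ nm'] exI[of _ "J \<union> {p, q}"] exI[of _ Z''] conjI allI impI)
qed

text \<open>\<open>c\<close> codes a finite set of pairs of a name and a token. The disjunct
  \<open>c < i\<close> gives every unlisted token the default name \<open>c + 1\<close>, so the
  search always ends.\<close>

definition name :: "nat \<Rightarrow> nat \<Rightarrow> nat" where
  "name c j = (LEAST i. pr i j \<in> set_decode c \<or> c < i)"

lemma good_exists: "\<exists>c. good g (name c) c"
proof -
  let ?S = "\<lambda>j. supp (g j)" and ?M = "2 * (g 0 + 3)"
  have "infinite (UNIV - {0::nat})" by simp
  from disjoint_pairs[of ?S, OF finite_supp this, of ?M]
  obtain nm J Z where J: "finite J" "J \<subseteq> UNIV - {0}" and Z: "infinite Z" "Z \<subseteq> UNIV - {0} - J"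
    and pq: "\<And>i. i < ?M \<Longrightarrow> \<exists>p\<in>J. \<exists>q\<in>J. nm p = i \<and> nm q = i \<and> (\<forall>z\<in>Z. ?S p \<inter> ?S q \<subseteq> ?S z)"
    by blast
  obtain z where z: "z \<in> Z" using infinite_imp_nonempty[OF Z(1)] by blast
  define nm' where "nm' = nm(0 := ?M, z := ?M)"
  define X where "X = (\<lambda>j. pr (nm' j) j) ` (J \<union> {0, z})"
  define c where "c = set_encode X"
  have "finite X" unfolding X_def using J(1) by simp
  then have c: "set_decode c = X" unfolding c_def by simp
  have bound: "j \<le> c" "nm' j \<le> c" if "j \<in> J \<union> {0, z}" for j
  proof -
    have "pr (nm' j) j < c" using that by (intro set_decode_less) (auto simp: c X_def)
    then show "j \<le> c" "nm' j \<le> c"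
      using le_prod_encode_1[of "nm' j" j] le_prod_encode_2[of j "nm' j"] by linarith+
  qed
  have name: "name c j = nm' j" if "j \<in> J \<union> {0, z}" for j
    unfolding name_def
  proof (rule Least_equality)
    show "pr (nm' j) j \<in> set_decode c \<or> c < nm' j" using that by (auto simp: c X_def)
    show "nm' j \<le> i" if "pr i j \<in> set_decode c \<or> c < i" for i
      using that bound(2)[OF \<open>j \<in> J \<union> {0, z}\<close>] by (auto simp: c X_def)
  qed
  have nm': "nm' 0 = ?M" "nm' z = ?M" "p \<in> J \<Longrightarrow> nm' p = nm p" for p
    using J(2) Z(2) z by (auto simp: nm'_def)
  have "name c 0 = name c z" using name nm' by simp
  moreover have "\<exists>p\<le>c. \<exists>q\<le>c. name c p = i \<and> name c q = i \<and>
      (\<forall>u\<le>g p. u \<in> ?S p \<and> u \<in> ?S q \<longrightarrow> u \<in> ?S 0 \<or> u \<in> ?S z)" if "i < ?M" for i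
  proof -
    from pq[OF that] obtain p q where "p \<in> J" "q \<in> J" "nm p = i" "nm q = i" "?S p \<inter> ?S q \<subseteq> ?S z"
      using z by blast
    moreover from this have "p \<le> c" "q \<le> c" "name c p = i" "name c q = i"
      using name nm'(3) bound(1) by auto
    ultimately show ?thesis by (intro exI[of _ p] exI[of _ q]) blast
  qed
  moreover have "z \<le> c" using bound by simp
  ultimately have "good g (name c) c"
    unfolding good_def by - (rule exI[of _ z], intro conjI allI impI)
  then show ?thesis by blast
qed

section \<open>The diagonal program\<close>

primrec ConstP :: "nat \<Rightarrow> prog" where
  "ConstP 0 = ZeroP"
| "ConstP (Suc n) = CompP SuccP (ConstP n)"

lemma computes_ConstP: "computes (ConstP n) x n"
  by (induction n) (auto intro: computes.intros)

lemma computable_code_ConstP: "computable (\<lambda>n. prog_encode (ConstP n))"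
proof -
  \<comment> \<open>Since \<open>SuccP\<close> has code 1, \<open>4 * pr 1 r + 5\<close> is the code
    of its composition with the program coded by \<open>r\<close>.\<close>
  have "rec_nat 0 (\<lambda>n r. 4 * pr 1 r + 5) n = prog_encode (ConstP n)" for n
    by (induction n) auto
  moreover have "computable (\<lambda>n. rec_nat 0 (\<lambda>n r. 4 * pr 1 r + 5) n)"
    by (intro computable_rec_nat comp_intros)
  ultimately show ?thesis by simp
qed

text \<open>Program \<open>e\<close> is run on its own code, which saves the recursion theorem.\<close>

definition token :: "nat \<Rightarrow> nat \<Rightarrow> nat" where
  "token e j = prog_encode (CompP (prog_decode e) (ConstP (pr e j)))"

text \<open>The embedded constant program outputs \<open>pr e j\<close>, so \<open>j\<close> can be
  recovered from the code.\<close>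

lemma token_eq_iff [simp]: "token e i = token e j \<longleftrightarrow> i = j"
proof
  assume "token e i = token e j"
  then have "ConstP (pr e i) = ConstP (pr e j)"
    unfolding token_def using inj_prog_encode by (auto dest: injD)
  then have "pr e i = pr e j" using computes_ConstP computes_deterministic by metis
  then show "i = j" by simp
qed simp

text \<open>The constant program discards the argument, so a token behaves on its own index, which
  is what the jump inspects, as on any other input.\<close>

lemma phi_token: "phi (token e j) x = Some v \<longleftrightarrow> computes (prog_decode e) (pr e j) v"
proof -
  have "computes (CompP p (ConstP n)) x v \<longleftrightarrow> computes p n v" for p n
    using computes_ConstP computes_deterministic by (blast intro: computes.comp elim: computes_elims)
  then show ?thesis by (simp add: phi_eq_Some_iff token_def del: prog_encode.simps)
qed

lemma computable_token [comp_intros]: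
  assumes "computable e" "computable j"
  shows "computable (\<lambda>z. token (e z) (j z))"
  unfolding token_def prog_encode.simps prog_encode_decode
  by (intro comp_intros computable_compose[OF computable_code_ConstP] assms)

text \<open>The search only decides whether the program halts. Its witness is discarded, so the
  output does not depend on the stage found.\<close>

lemma search_program:
  assumes "decidable (\<lambda>z. R (pf z) (ps z))" "computable h"
  obtains p where "\<And>x v. computes p x v \<longleftrightarrow> (\<exists>w. R x w) \<and> v = h x"
proof -
  obtain r where r: "\<And>z. computes r z (if R (pf z) (ps z) then 0 else 1)"
    using assms(1) unfolding decidable_def computable_def by blast
  have "computable (\<lambda>z. h (pf z))" by (intro computable_compose[OF assms(2)] comp_intros)
  then obtain t where t: "\<And>z. computes t z (h (pf z))" unfolding computable_def by blast
  obtain i where i: "\<And>x. computes i x x" using computable_id unfolding computable_def by blast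
  have "computes (CompP t (PairP i (MuP r))) x v \<longleftrightarrow> (\<exists>w. R x w) \<and> v = h x" for x v
  proof
    assume "computes (CompP t (PairP i (MuP r))) x v"
    then obtain y where "computes (PairP i (MuP r)) x y" and y: "computes t y v"
      by (auto elim: computes_elims)
    then obtain a w where *: "computes i x a" "computes (MuP r) x w" "y = pr a w"
      by (auto elim: computes_elims)
    have "a = x" using computes_deterministic[OF *(1) i] .
    then have "v = h x" using computes_deterministic[OF y t] *(3) by simp
    moreover have "R x w" using *(2) unfolding computes_MuP[of r R, OF r] by blast
    ultimately show "(\<exists>w. R x w) \<and> v = h x" by blast
  next
    assume *: "(\<exists>w. R x w) \<and> v = h x"
    then have "computes (MuP r) x (LEAST w. R x w)"
      unfolding computes_MuP[of r R, OF r] by (auto intro: LeastI_ex dest: not_less_Least)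
    from computes.comp[OF computes.pair[OF i this] t] *
    show "computes (CompP t (PairP i (MuP r))) x v" by simp
  qed
  then show thesis using that by blast
qed

lemma computable_div2 [comp_intros]:
  assumes "computable f"
  shows "computable (\<lambda>x. f x div 2)"
proof -
  have "n div 2 = (LEAST m. n < 2 * m + 2)" for n :: nat
    by (rule Least_equality[symmetric]) linarith+
  moreover have "computable (\<lambda>x. LEAST m. x < 2 * m + 2)"
  proof (rule computable_Least)
    show "decidable (\<lambda>z. pf z < 2 * ps z + 2)" by (intro comp_intros)
    show "\<exists>m. x < 2 * m + 2" for x :: nat by (intro exI[of _ x]) simp
  qed
  ultimately have "computable (\<lambda>x. x div 2)" by simp
  from computable_compose[OF this assms] show ?thesis .
qed

lemma computable_name [comp_intros]:
  assumes "computable c" "computable j"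
  shows "computable (\<lambda>z. name (c z) (j z))"
proof -
  have "computable (\<lambda>x. LEAST i. pr i (ps x) \<in> set_decode (pf x) \<or> pf x < i)"
  proof (rule computable_Least)
    show "decidable (\<lambda>z. pr (ps z) (ps (pf z)) \<in> set_decode (pf (pf z)) \<or> pf (pf z) < ps z)"
      by (intro comp_intros)
    show "\<exists>i. pr i (ps x) \<in> set_decode (pf x) \<or> pf x < i" for x by blast
  qed
  from computable_compose[OF this computable_pr[OF assms]] show ?thesis
    unfolding name_def by simp
qed

lemma decidable_test:
  assumes g: "\<And>a b. computable a \<Longrightarrow> computable b \<Longrightarrow> computable (\<lambda>z. g (a z) (b z))"
    and "computable e" "computable c" "computable w" "computable k"
  shows "decidable (\<lambda>z. test (g (e z)) (name (c z)) (c z) (w z) (k z))"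
  unfolding test_def related_def
  by (intro comp_intros g assms(2-) assms(2-)[THEN computable_compose])

lemma decidable_good:
  assumes g: "\<And>a b. computable a \<Longrightarrow> computable b \<Longrightarrow> computable (\<lambda>z. g (a z) (b z))"
  shows "decidable (\<lambda>z. good (g (pf z)) (name (ps z)) (ps z))"
  unfolding good_def by (intro comp_intros g)

theorem theorem9p2: "\<not> halting_jump H_rel \<le>\<^sub>c omega_jump H_rel"
proof
  assume "halting_jump H_rel \<le>\<^sub>c omega_jump H_rel"
  then obtain f where "total_computable f"
    and f: "\<And>x y. (x, y) \<in> halting_jump H_rel \<longleftrightarrow> (f x, f y) \<in> omega_jump H_rel"
    unfolding reducible_def by blast
  then have f_comp: "computable f"
    unfolding total_computable_def computable_def phi_eq_Some_iff by blast
  \<comment> \<open>Tag 0 marks the tokens proper, tag 1 the names.\<close>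
  define g where "g e j = f (token e (pr 0 j))" for e j
  have g: "computable (\<lambda>z. g (a z) (b z))" if "computable a" "computable b" for a b
    unfolding g_def by (intro computable_compose[OF f_comp] comp_intros that)
  \<comment> \<open>Which naming is good depends on the images of the tokens of \<open>e\<close>, so
    it is searched for computably in \<open>e\<close>.\<close>
  define c where "c e = (LEAST c. good (g e) (name c) c)" for e
  have c_comp: "computable c"
    unfolding c_def by (rule computable_Least[OF decidable_good]) (auto intro: g good_exists)
  \<comment> \<open>A token proper halts at once, whereas a name waits for the test of its pair to
    succeed.\<close>
  define R where "R z w \<longleftrightarrow> pf (ps z) = 0 \<or>
    test (g (pf z)) (name (c (pf z))) (c (pf z)) w (ps (ps z) div 2)" for z w
  \<comment> \<open>A token proper outputs the index of the name it carries. Both names of pair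
    \<open>k\<close> output \<open>k\<close>, so halting identifies them under H and keeps different
    pairs apart.\<close>
  define h where "h z = (if pf (ps z) = 0
    then token (pf z) (pr 1 (name (c (pf z)) (ps (ps z)))) else ps (ps z) div 2)" for z
  have R_dec: "decidable (\<lambda>z. R (pf z) (ps z))"
    unfolding R_def by (intro comp_intros decidable_test g computable_compose[OF c_comp])
  have h_comp: "computable h"
    unfolding h_def by (intro comp_intros computable_compose[OF c_comp])
  obtain q where q: "\<And>x v. computes q x v \<longleftrightarrow> (\<exists>w. R x w) \<and> v = h x"
    using search_program[OF R_dec h_comp] by metis
  \<comment> \<open>So far \<open>e\<close> was a parameter. As the code of \<open>q\<close> it
    makes the tests run by the program concern the tokens built from that program.\<close>
  define e where "e = prog_encode q"
  let ?Y = "\<lambda>j. token e (pr 0 j)" and ?A = "\<lambda>i. token e (pr 1 i)" and ?nm = "name (c e)"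
  let ?T = "\<lambda>k. \<exists>w. test (g e) ?nm (c e) w k"
  have phi: "phi (token e j) x = Some v \<longleftrightarrow> (\<exists>w. R (pr e j) w) \<and> v = h (pr e j)" for j x v
    by (simp add: phi_token q e_def)
  have Y: "phi (?Y j) x = Some v \<longleftrightarrow> v = ?A (?nm j)" for j x v
    unfolding phi R_def h_def by simp
  have A: "phi (?A i) x = Some v \<longleftrightarrow> ?T (i div 2) \<and> v = i div 2" for i x v
    unfolding phi R_def h_def by simp
  have "(g e i, g e j) \<in> omega_jump H_rel \<longleftrightarrow>
      ?nm i = ?nm j \<or> ?nm i div 2 = ?nm j div 2 \<and> ?T (?nm i div 2)" for i j
  proof -
    \<comment> \<open>Every \<open>?Y j\<close> halts with value \<open>?A (?nm j)\<close>, so the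
      halting jump compares distinct tokens by comparing their names under H.\<close>
    have "(g e i, g e j) \<in> omega_jump H_rel \<longleftrightarrow> i = j \<or> (?A (?nm i), ?A (?nm j)) \<in> H_rel"
      unfolding g_def f[symmetric] halting_jump_def by (simp add: Y)
    also have "(?A (?nm i), ?A (?nm j)) \<in> H_rel \<longleftrightarrow>
        ?nm i = ?nm j \<or> ?nm i div 2 = ?nm j div 2 \<and> ?T (?nm i div 2)"
      unfolding H_rel_def mem_Collect_eq prod.case A by auto
    finally show ?thesis by auto
  qed
  moreover have "good (g e) ?nm (c e)"
    unfolding c_def using good_exists by (rule LeastI_ex)
  ultimately show False by (rule good_contradiction[rotated])
qed

end
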